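(* Let $T\in{\rm Aut}(X,\mathcal B,\mu)$ be ergodic with measure-theoretic entropy $h(T)=0$. Then the topological entropy of the topological lens $(C_2(\mu),\widetilde T)$ is zero.
   Context: $C_2(\mu)$: probability measures on $X\times X$ with both marginals $\mu$, with the compact metrizable topology $\rho_n\to\rho$ iff $\rho_n(A\times B)\to\rho(A\times B)$ for all measurable $A,B$; the topological lens is $\widetilde T(\rho)(A\times B)=\rho(T^{-1}A\times T^{-1}B)$. *)

theory Defs
  imports "HOL-Probability.Probability"
begin

definition is_aut :: "'a measure \<Rightarrow> ('a \<Rightarrow> 'a) \<Rightarrow> bool" where
  "is_aut M T \<longleftrightarrow> bij_betw T (space M) (space M) \<and> T \<in> measurable M M
     \<and> the_inv_into (space M) T \<in> measurable M M \<and> distr M M T = M"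

definition ergodic :: "'a measure \<Rightarrow> ('a \<Rightarrow> 'a) \<Rightarrow> bool" where
  "ergodic M T \<longleftrightarrow> (\<forall>A\<in>sets M. T -` A \<inter> space M = A \<longrightarrow>
       measure M A = 0 \<or> measure M A = 1)"

definition finite_meas_partition :: "'a measure \<Rightarrow> 'a set set \<Rightarrow> bool" where
  "finite_meas_partition M P \<longleftrightarrow> finite P \<and> P \<subseteq> sets M \<and> disjoint P \<and> \<Union>P = space M"

definition part_entropy :: "'a measure \<Rightarrow> 'a set set \<Rightarrow> real" where
  "part_entropy M P = (\<Sum>A\<in>P. if measure M A = 0 then 0
        else - measure M A * ln (measure M A))"

definition part_join :: "'a measure \<Rightarrow> ('a \<Rightarrow> 'a) \<Rightarrow> 'a set set \<Rightarrow> nat \<Rightarrow> 'a set set" where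
  "part_join M T P n = {(\<Inter>i<n. (T ^^ i) -` (f i)) \<inter> space M | f. \<forall>i<n. f i \<in> P}"

definition entropy_rel :: "'a measure \<Rightarrow> ('a \<Rightarrow> 'a) \<Rightarrow> 'a set set \<Rightarrow> real" where
  "entropy_rel M T P = lim (\<lambda>n. part_entropy M (part_join M T P n) / real n)"

definition ks_entropy :: "'a measure \<Rightarrow> ('a \<Rightarrow> 'a) \<Rightarrow> ereal" where
  "ks_entropy M T = (SUP P\<in>{P. finite_meas_partition M P}. ereal (entropy_rel M T P))"

definition open_covers :: "'b topology \<Rightarrow> 'b set set set" where
  "open_covers X = {U. (\<forall>V\<in>U. openin X V) \<and> \<Union>U = topspace X}"

definition cover_num :: "'b topology \<Rightarrow> 'b set set \<Rightarrow> nat" where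
  "cover_num X U = Inf {card V | V. V \<subseteq> U \<and> finite V \<and> \<Union>V = topspace X}"

definition cover_join :: "'b topology \<Rightarrow> ('b \<Rightarrow> 'b) \<Rightarrow> 'b set set \<Rightarrow> nat \<Rightarrow> 'b set set" where
  "cover_join X f U n = {(\<Inter>i<n. (f ^^ i) -` (g i)) \<inter> topspace X | g. \<forall>i<n. g i \<in> U}"

definition cover_entropy :: "'b topology \<Rightarrow> ('b \<Rightarrow> 'b) \<Rightarrow> 'b set set \<Rightarrow> real" where
  "cover_entropy X f U = lim (\<lambda>n. ln (real (cover_num X (cover_join X f U n))) / real n)"

definition top_entropy :: "'b topology \<Rightarrow> ('b \<Rightarrow> 'b) \<Rightarrow> ereal" where
  "top_entropy X f = (SUP U\<in>open_covers X. ereal (cover_entropy X f U))"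

definition C2 :: "'a measure \<Rightarrow> ('a \<times> 'a) measure set" where
  "C2 M = {\<rho>. sets \<rho> = sets (M \<Otimes>\<^sub>M M) \<and> prob_space \<rho>
              \<and> distr \<rho> M fst = M \<and> distr \<rho> M snd = M}"

definition C2_topology :: "'a measure \<Rightarrow> ('a \<times> 'a) measure topology" where
  "C2_topology M = topology_generated_by
     {{\<rho>\<in>C2 M. measure \<rho> (A \<times> B) \<in> W} | A B W. A \<in> sets M \<and> B \<in> sets M \<and> open W}"

definition lens :: "'a measure \<Rightarrow> ('a \<Rightarrow> 'a) \<Rightarrow> ('a \<times> 'a) measure \<Rightarrow> ('a \<times> 'a) measure" where
  "lens M T \<rho> = distr \<rho> (M \<Otimes>\<^sub>M M) (\<lambda>(x, y). (T x, T y))"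

end

theory Submission
  imports Defs
begin

text \<open>
  By compactness of the space of couplings, an open cover is refined by neighbourhoods that control
  the mass of finitely many rectangles up to \<open>e\<close>; let \<open>P\<close> be a finite partition refining the sides
  of these rectangles. Zero entropy gives, for every \<open>s > 0\<close> and large \<open>n\<close>, at most \<open>exp (s n)\<close>
  atoms of the \<open>n\<close>-fold join of \<open>P\<close> that carry all but mass \<open>s\<close>. Hence, up to \<open>2 s\<close>, the rectangle
  masses along an orbit segment of length \<open>n\<close> of any coupling form a convex combination of at most
  \<open>1 + exp (2 s n)\<close> vectors with entries in \<open>{0, 1}\<close>. Maurey's argument approximates such a
  combination by an average of \<open>m\<close> of these vectors with quadratic error at most \<open>1 / m\<close> per
  coordinate, so outside a small proportion of the coordinates the approximation is uniformly good.
  Recording the \<open>m\<close> vectors together with rounded values on the exceptional coordinates codes the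
  orbit segment by one of \<open>exp (\<epsilon> n)\<close> words, with \<open>\<epsilon>\<close> as small as desired.
\<close>

text \<open>Two direct counts fail. Rounding the weights that a coupling gives to the exp (2 s n)
  pairs of large atoms produces doubly exponentially many cases; rounding all n * card F rectangle
  masses independently produces exponentially many, at a rate that does not shrink with s. Maurey's
  averages replace the weights by a list of fixed length m, and the lists cost only a constant times
  exp (2 s m n). Asking for a good average at every coordinate, say by random sampling and a union
  bound, would need m of order ln n and spoil this count. With m fixed, the quadratic error leaves a
  fraction of at most 1 / (m d^2) bad coordinates, and values on such a sparse set are cheap to
  list. This dictates the order of choices: the Chernoff weight z from the tolerance d, then m from
  z, then s from m, and n last.\<close>

section \<open>Coding convex combinations in the supremum norm\<close>

text \<open>The list is chosen greedily: the average over \<open>D\<close> of the inner products of \<open>x d - v\<close> with the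
  accumulated error is zero, so some \<open>d\<close> does not increase the cross term.\<close>

lemma maurey_greedy_list:
  fixes x :: "'d \<Rightarrow> 'i \<Rightarrow> real"
  assumes D: "finite D" and w: "\<And>d. d \<in> D \<Longrightarrow> 0 \<le> w d" "sum w D = 1"
    and x01: "\<And>d i. d \<in> D \<Longrightarrow> i \<in> I \<Longrightarrow> x d i \<in> {0..1}"
    and v: "\<And>i. i \<in> I \<Longrightarrow> v i = (\<Sum>d\<in>D. w d * x d i)"
  shows "\<exists>t. length t = m \<and> set t \<subseteq> D \<and> (\<Sum>i\<in>I. (\<Sum>d\<leftarrow>t. x d i - v i)\<^sup>2) \<le> real m * real (card I)"
proof (induction m)
  case 0
  then show ?case by simp
next
  case (Suc m)
  then obtain t where t: "length t = m" "set t \<subseteq> D"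
    and le: "(\<Sum>i\<in>I. (\<Sum>d\<leftarrow>t. x d i - v i)\<^sup>2) \<le> real m * real (card I)" by blast
  define S where "S i = (\<Sum>d\<leftarrow>t. x d i - v i)" for i
  have v01: "v i \<in> {0..1}" if "i \<in> I" for i
  proof -
    have "(\<Sum>d\<in>D. w d * x d i) \<le> (\<Sum>d\<in>D. w d * 1)"
      using w x01 that by (intro sum_mono mult_left_mono) auto
    moreover have "0 \<le> (\<Sum>d\<in>D. w d * x d i)"
      using w x01 that by (intro sum_nonneg) auto
    ultimately show ?thesis using v[OF that] w by simp
  qed
  have "\<exists>d\<in>D. (\<Sum>i\<in>I. S i * (x d i - v i)) \<le> 0"
  proof (rule ccontr)
    assume "\<not> ?thesis"
    then have pos: "0 < (\<Sum>i\<in>I. S i * (x d i - v i))" if "d \<in> D" for d using that by force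
    obtain d0 where d0: "d0 \<in> D" "w d0 \<noteq> 0" using w(2) by (metis sum.neutral zero_neq_one)
    have "0 < (\<Sum>d\<in>D. w d * (\<Sum>i\<in>I. S i * (x d i - v i)))"
    proof (rule sum_pos2[OF D d0(1)])
      show "0 < w d0 * (\<Sum>i\<in>I. S i * (x d0 i - v i))"
        using pos[OF d0(1)] w(1)[OF d0(1)] d0(2) by simp
    qed (intro mult_nonneg_nonneg less_imp_le[OF pos] w)
    also have "\<dots> = (\<Sum>i\<in>I. \<Sum>d\<in>D. S i * (w d * x d i - w d * v i))"
      by (subst sum.swap) (simp add: sum_distrib_left algebra_simps)
    also have "\<dots> = (\<Sum>i\<in>I. S i * ((\<Sum>d\<in>D. w d * x d i) - sum w D * v i))"
      by (simp add: sum_distrib_left sum_subtractf sum_distrib_right right_diff_distrib)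
    also have "\<dots> = 0" using v w by simp
    finally show False by simp
  qed
  then obtain d where d: "d \<in> D" "(\<Sum>i\<in>I. S i * (x d i - v i)) \<le> 0" by blast
  have "(\<Sum>i\<in>I. (\<Sum>d\<leftarrow>d # t. x d i - v i)\<^sup>2)
      = (\<Sum>i\<in>I. (S i)\<^sup>2) + 2 * (\<Sum>i\<in>I. S i * (x d i - v i)) + (\<Sum>i\<in>I. (x d i - v i)\<^sup>2)"
  proof -
    have "(\<Sum>d\<leftarrow>d # t. x d i - v i)\<^sup>2 = (S i)\<^sup>2 + 2 * (S i * (x d i - v i)) + (x d i - v i)\<^sup>2" for i
      by (simp add: S_def[symmetric] power2_eq_square algebra_simps)
    then show ?thesis by (simp only: sum.distrib sum_distrib_left)
  qed
  also have "\<dots> \<le> real m * real (card I) + 0 + (\<Sum>i\<in>I. 1)"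
  proof (intro add_mono sum_mono)
    fix i assume i: "i \<in> I"
    \<comment> \<open>Both \<open>x d i\<close> and the mean \<open>v i\<close> lie in the unit
      interval, so one more vector adds at most 1 per coordinate; this is the linear growth in
      \<open>m\<close>.\<close>
    have "\<bar>x d i - v i\<bar> \<le> 1" using x01[OF d(1) i] v01[OF i] by auto
    then show "(x d i - v i)\<^sup>2 \<le> 1" by (simp add: abs_square_le_1)
  qed (use le d S_def in auto)
  also have "\<dots> = real (Suc m) * real (card I)" by (simp add: algebra_simps)
  finally show ?case using t d by (intro exI[of _ "d # t"]) auto
qed

text \<open>Chernoff bound: weight every function by \<open>z\<close> to the number of its nonzero values.\<close>

lemma card_sparse_functions_le:
  fixes z r :: real and L :: nat
  assumes I: "finite I" and z: "0 < z" "z \<le> 1"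
  shows "real (card {f \<in> I \<rightarrow>\<^sub>E {..L}. real (card {i\<in>I. f i \<noteq> 0}) \<le> r})
    \<le> z powr (- r) * (1 + real L * z) ^ card I"
proof -
  let ?S = "{f \<in> I \<rightarrow>\<^sub>E {..L}. real (card {i\<in>I. f i \<noteq> 0}) \<le> r}"
  let ?c = "\<lambda>f::_ \<Rightarrow> nat. card {i\<in>I. f i \<noteq> 0}"
  have fin: "finite (I \<rightarrow>\<^sub>E {..L})" using I by (intro finite_PiE) auto
  have "real (card ?S) = (\<Sum>f\<in>?S. 1)" by simp
  also have "\<dots> \<le> (\<Sum>f\<in>?S. z powr (- r) * z ^ ?c f)"
  proof (rule sum_mono)
    fix f assume "f \<in> ?S"
    then have "real (?c f) - r \<le> 0" by simp
    then have "1 \<le> z powr (real (?c f) - r)"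
      using z powr_mono'[of "real (?c f) - r" 0 z] by simp
    also have "\<dots> = z powr (- r) * z ^ ?c f"
      using z by (simp add: powr_diff powr_minus powr_realpow divide_inverse mult.commute)
    finally show "1 \<le> z powr (- r) * z ^ ?c f" .
  qed
  also have "\<dots> \<le> (\<Sum>f\<in>I \<rightarrow>\<^sub>E {..L}. z powr (- r) * z ^ ?c f)"
    using fin z by (intro sum_mono2) auto
  also have "\<dots> = z powr (- r) * (\<Sum>f\<in>I \<rightarrow>\<^sub>E {..L}. z ^ ?c f)"
    by (simp add: sum_distrib_left)
  \<comment> \<open>Written as a product over coordinates, the weight sum factorises: the value 0
    contributes 1 and each of the \<open>L\<close> other values contributes
    \<open>z\<close>.\<close>
  also have "(\<Sum>f\<in>I \<rightarrow>\<^sub>E {..L}. z ^ ?c f) = (\<Sum>f\<in>I \<rightarrow>\<^sub>E {..L}. \<Prod>i\<in>I. if f i \<noteq> 0 then z else 1)"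
    using I by (intro sum.cong refl) (simp add: prod.If_cases Int_def)
  also have "\<dots> = (\<Prod>i\<in>I. \<Sum>k\<in>{..L}. if k \<noteq> 0 then z else 1)"
    using I by (subst prod_sum_PiE) auto
  also have "(\<Sum>k\<in>{..L}. if k \<noteq> 0 then z else 1) = 1 + real L * z"
    by (simp add: atMost_atLeast0 sum.atLeast_Suc_atMost)
  finally show ?thesis by simp
qed

text \<open>By \<open>maurey_greedy_list\<close> and Chebyshev's inequality, the average of the
  \<open>m\<close> listed vectors is off by more than \<open>e\<close> on at most
  \<open>card I / (m * e\<^sup>2)\<close> coordinates, where a rounded value is recorded instead.
  The count involves distinct vectors \<open>x d\<close> rather than indices \<open>d\<close>,
  because many indices may share the zero vector when the lemma is applied.\<close>

lemma convex_hull_sup_coding: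
  fixes x :: "'d \<Rightarrow> 'i \<Rightarrow> real" and H :: "('i \<Rightarrow> real) set" and e z :: real
  assumes D: "finite D" and I: "finite I"
    and x01: "\<And>d i. d \<in> D \<Longrightarrow> i \<in> I \<Longrightarrow> x d i \<in> {0..1}"
    and e: "0 < e" and m: "0 < m" and z: "0 < z" "z \<le> 1"
    and H: "\<forall>u\<in>H. \<exists>w. (\<forall>d\<in>D. 0 \<le> w d) \<and> sum w D = 1 \<and> (\<forall>i\<in>I. u i = (\<Sum>d\<in>D. w d * x d i))"
  shows "\<exists>code :: ('i \<Rightarrow> real) \<Rightarrow> ('i \<Rightarrow> real) list \<times> ('i \<Rightarrow> nat). finite (code ` H) \<and>
    real (card (code ` H)) \<le> real (card (x ` D)) ^ m *
      (z powr (- (real (card I) / (real m * e\<^sup>2))) * (1 + (1 / e + 1) * z) ^ card I) \<and>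
    (\<forall>u\<in>H. \<forall>v\<in>H. code u = code v \<longrightarrow> (\<forall>i\<in>I. \<bar>u i - v i\<bar> \<le> 2 * e))"
proof -
  define L where "L = Suc (nat \<lfloor>1 / e\<rfloor>)"
  define r where "r = real (card I) / (real m * e\<^sup>2)"
  define avg where "avg t i = (\<Sum>y\<leftarrow>t. y i) / real m" for t :: "('i \<Rightarrow> real) list" and i
  have u01: "u i \<in> {0..1}" if u: "u \<in> H" and i: "i \<in> I" for u i
  proof -
    obtain w where w: "\<forall>d\<in>D. 0 \<le> w d" "sum w D = 1" "\<forall>i\<in>I. u i = (\<Sum>d\<in>D. w d * x d i)"
      using bspec[OF H u] by blast
    have "(\<Sum>d\<in>D. w d * x d i) \<le> (\<Sum>d\<in>D. w d * 1)"
      using w x01 i by (intro sum_mono mult_left_mono) auto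
    moreover have "0 \<le> (\<Sum>d\<in>D. w d * x d i)"
      using w x01 i by (intro sum_nonneg) auto
    ultimately show ?thesis using w i by simp
  qed
  have ex: "\<exists>t. length t = m \<and> set t \<subseteq> x ` D \<and> real (card {i\<in>I. \<bar>avg t i - u i\<bar> > e}) \<le> r" if u: "u \<in> H" for u
  proof -
    obtain w where w: "\<forall>d\<in>D. 0 \<le> w d" "sum w D = 1" "\<forall>i\<in>I. u i = (\<Sum>d\<in>D. w d * x d i)"
      using bspec[OF H u] by blast
    obtain t where t: "length t = m" "set t \<subseteq> D"
      and le: "(\<Sum>i\<in>I. (\<Sum>d\<leftarrow>t. x d i - u i)\<^sup>2) \<le> real m * real (card I)"
      using maurey_greedy_list[OF D, of w I x u m] w x01 by auto
    have av: "(\<Sum>d\<leftarrow>t. x d i - u i) = real m * (avg (map x t) i - u i)" for i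
      using m t(1) by (simp add: avg_def sum_list_subtractf sum_list_triv o_def right_diff_distrib)
    let ?B = "{i\<in>I. \<bar>avg (map x t) i - u i\<bar> > e}"
    have "real (card ?B) * (real m * e)\<^sup>2 = (\<Sum>i\<in>?B. (real m * e)\<^sup>2)" by simp
    also have "\<dots> \<le> (\<Sum>i\<in>?B. (\<Sum>d\<leftarrow>t. x d i - u i)\<^sup>2)"
    proof (rule sum_mono)
      fix i assume "i \<in> ?B"
      then have "real m * e \<le> \<bar>\<Sum>d\<leftarrow>t. x d i - u i\<bar>" using m by (simp add: av abs_mult)
      then have "(real m * e)\<^sup>2 \<le> \<bar>\<Sum>d\<leftarrow>t. x d i - u i\<bar>\<^sup>2" using e by (intro power_mono) auto
      then show "(real m * e)\<^sup>2 \<le> (\<Sum>d\<leftarrow>t. x d i - u i)\<^sup>2" by simp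
    qed
    also have "\<dots> \<le> (\<Sum>i\<in>I. (\<Sum>d\<leftarrow>t. x d i - u i)\<^sup>2)" using I by (intro sum_mono2) auto
    also have "\<dots> \<le> real m * real (card I)" by (rule le)
    finally have "real (card ?B) \<le> r" using m e
      by (simp add: r_def field_simps power2_eq_square)
    then show ?thesis using t by (intro exI[of _ "map x t"]) auto
  qed
  then obtain t where t: "\<And>u. u \<in> H \<Longrightarrow> length (t u) = m" "\<And>u. u \<in> H \<Longrightarrow> set (t u) \<subseteq> x ` D"
    "\<And>u. u \<in> H \<Longrightarrow> real (card {i\<in>I. \<bar>avg (t u) i - u i\<bar> > e}) \<le> r" by metis
  \<comment> \<open>The symbol 0 says that the average is accurate enough; the successor keeps a
    rounded value 0 apart from it. As \<open>u i\<close> is at most 1, no symbol exceeds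
    \<open>L\<close>.\<close>
  define b where "b u = (\<lambda>i\<in>I. if \<bar>avg (t u) i - u i\<bar> > e then Suc (nat \<lfloor>u i / e\<rfloor>) else 0)" for u
  define code where "code u = (t u, b u)" for u
  let ?T = "{t. set t \<subseteq> x ` D \<and> length t = m}"
  let ?F = "{f \<in> I \<rightarrow>\<^sub>E {..L}. real (card {i\<in>I. f i \<noteq> 0}) \<le> r}"
  have sub: "code ` H \<subseteq> ?T \<times> ?F"
  proof -
    have "b u \<in> ?F" if u: "u \<in> H" for u
    proof -
      have "{i\<in>I. b u i \<noteq> 0} = {i\<in>I. \<bar>avg (t u) i - u i\<bar> > e}" by (auto simp: b_def)
      moreover have "\<lfloor>u i / e\<rfloor> \<le> \<lfloor>1 / e\<rfloor>" if "i \<in> I" for i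
        using u01[OF u that] e by (intro floor_mono divide_right_mono) auto
      then have "b u \<in> I \<rightarrow>\<^sub>E {..L}" by (auto simp: b_def L_def nat_mono)
      ultimately show ?thesis using t(3)[OF u] by simp
    qed
    then show ?thesis using t(1,2) by (simp add: code_def image_subset_iff)
  qed
  have finT: "finite ?T" using D by (intro finite_lists_length_eq) auto
  have finF: "finite ?F" using I by (intro finite_subset[OF _ finite_PiE[of I "\<lambda>_. {..L}"]]) auto
  have "real (card (code ` H)) \<le> real (card (?T \<times> ?F))"
    using sub finT finF by (intro of_nat_mono card_mono finite_cartesian_product) auto
  also have "\<dots> = real (card (x ` D)) ^ m * real (card ?F)"
    using D by (simp add: card_cartesian_product card_lists_length_eq)
  also have "\<dots> \<le> real (card (x ` D)) ^ m * (z powr (- r) * (1 + real L * z) ^ card I)"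
    by (intro mult_left_mono card_sparse_functions_le I z) auto
  also have "\<dots> \<le> real (card (x ` D)) ^ m * (z powr (- r) * (1 + (1 / e + 1) * z) ^ card I)"
  proof -
    have "real L \<le> 1 / e + 1" unfolding L_def using e by simp
    then have "1 + real L * z \<le> 1 + (1 / e + 1) * z" using z by (simp add: mult_right_mono)
    then show ?thesis using z by (intro mult_left_mono power_mono) auto
  qed
  finally have card: "real (card (code ` H)) \<le> \<dots>" .
  have close: "\<bar>u i - v i\<bar> \<le> 2 * e"
    if u: "u \<in> H" and v: "v \<in> H" and eq: "code u = code v" and i: "i \<in> I" for u v i
  proof -
    have tt: "t u = t v" and bb: "b u i = b v i" using eq by (auto simp: code_def)
    show ?thesis
    proof (cases "\<bar>avg (t u) i - u i\<bar> > e")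
      case False
      then have "\<not> \<bar>avg (t v) i - v i\<bar> > e" using bb i by (auto simp: b_def split: if_splits)
      then show ?thesis using False tt by auto
    next
      case True
      then have "nat \<lfloor>u i / e\<rfloor> = nat \<lfloor>v i / e\<rfloor>" using bb i by (auto simp: b_def split: if_splits)
      \<comment> \<open>Nonnegativity lets the floors be recovered from their images under
        \<open>nat\<close>.\<close>
      moreover have "0 \<le> \<lfloor>u i / e\<rfloor>" "0 \<le> \<lfloor>v i / e\<rfloor>" using u01 u v i e by auto
      ultimately have "\<lfloor>u i / e\<rfloor> = \<lfloor>v i / e\<rfloor>" by linarith
      then have "\<bar>u i / e - v i / e\<bar> < 1" by linarith
      then have "\<bar>u i - v i\<bar> / e < 1" using e by (simp flip: diff_divide_distrib)
      then show ?thesis using e by (simp add: field_simps)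
    qed
  qed
  show ?thesis
    using finite_subset[OF sub finite_cartesian_product[OF finT finF]] card close
    unfolding r_def by blast
qed

section \<open>Entropy of partitions\<close>

text \<open>Fekete's lemma: division of \<open>n\<close> by a nearly optimal \<open>k\<close> bounds
  the quotient from above. Since \<open>entropy_rel\<close> is defined through \<open>lim\<close>,
  it carries information about the joins only once convergence is known.\<close>

lemma fekete_convergent:
  fixes u :: "nat \<Rightarrow> real"
  assumes pos: "\<And>n. 0 \<le> u n" and sub: "\<And>m n. u (m + n) \<le> u m + u n"
  shows "convergent (\<lambda>n. u n / real n)"
proof -
  define L where "L = (INF n\<in>{1..}. u n / real n)"
  have bdd: "bdd_below ((\<lambda>n. u n / real n) ` {1..})"
    using pos by (intro bdd_belowI[of _ 0]) auto
  have mult: "u (q * k + r) \<le> real q * u k + u r" for q k r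
  proof (induction q)
    case (Suc q)
    have "u (Suc q * k + r) = u (k + (q * k + r))" by (simp add: algebra_simps)
    also have "\<dots> \<le> u k + u (q * k + r)" by (rule sub)
    finally show ?case using Suc by (simp add: algebra_simps)
  qed simp
  have "(\<lambda>n. u n / real n) \<longlonglongrightarrow> L"
  proof (rule LIMSEQ_I)
    fix e :: real assume e: "0 < e"
    have "\<exists>k\<in>{1..}. u k / real k < L + e / 2"
      using cInf_lessD[of "(\<lambda>n. u n / real n) ` {1..}" "L + e / 2"] e by (force simp: L_def)
    then obtain k :: nat where k: "1 \<le> k" "u k / real k < L + e / 2" by auto
    \<comment> \<open>Every remainder \<open>n mod k\<close> is below \<open>k\<close>, so by
      nonnegativity this constant dominates all remainder terms and vanishes after division by
      \<open>n\<close>.\<close>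
    define C where "C = (\<Sum>r<k. u r)"
    obtain N :: nat where N: "C / (e / 2) < real N" using reals_Archimedean2 by blast
    have "norm (u n / real n - L) < e" if n: "n \<ge> max 1 N" for n
    proof -
      have n0: "0 < real n" using n by simp
      have "L \<le> u n / real n" unfolding L_def using n bdd by (intro cINF_lower) auto
      moreover have "u n / real n < L + e"
      proof -
        have "u (n mod k) \<le> C" unfolding C_def using k pos
          by (intro member_le_sum) auto
        then have "u n \<le> real (n div k) * u k + C"
          using mult[of "n div k" k "n mod k"] by simp
        also have "real (n div k) * u k = real (n div k * k) * (u k / real k)" using k by simp
        also have "\<dots> \<le> real n * (u k / real k)"
          using pos by (intro mult_right_mono of_nat_mono) auto
        finally have "u n / real n \<le> u k / real k + C / real n" using n0 by (simp add: field_simps)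
        moreover have "C / real n < e / 2"
          using N n e n0 by (simp add: field_simps) (smt (verit) mult_left_mono of_nat_le_iff)
        ultimately show ?thesis using k(2) by linarith
      qed
      ultimately show ?thesis by simp
    qed
    then show "\<exists>no. \<forall>n\<ge>no. norm (u n / real n - L) < e" by blast
  qed
  then show ?thesis by (rule convergentI)
qed

lemma part_entropy_eq: "part_entropy M P = (\<Sum>A\<in>P. - measure M A * ln (measure M A))"
  unfolding part_entropy_def by (intro sum.cong) auto

context prob_space
begin

lemma part_entropy_nonneg: "0 \<le> part_entropy M P"
  unfolding part_entropy_eq
proof (rule sum_nonneg)
  fix A
  show "0 \<le> - prob A * ln (prob A)"
    by (cases "prob A = 0")
      (simp_all add: mult_nonneg_nonpos zero_less_measure_iff)
qed

lemma partition_sum_measure: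
  assumes P: "finite_meas_partition M P" and A: "A \<in> sets M"
  shows "(\<Sum>a\<in>P. prob (a \<inter> A)) = prob A"
proof -
  have "A = (\<Union>a\<in>P. a \<inter> A)"
    using P sets.sets_into_space[OF A] unfolding finite_meas_partition_def by blast
  moreover have "disjoint_family_on (\<lambda>a. a \<inter> A) P"
    using P unfolding finite_meas_partition_def disjoint_family_on_def disjoint_def by blast
  moreover have "finite P" "(\<lambda>a. a \<inter> A) ` P \<subseteq> sets M"
    using P A by (auto simp: finite_meas_partition_def)
  ultimately show ?thesis
    using finite_measure_finite_Union[of P "\<lambda>a. a \<inter> A"] by simp
qed

lemma partition_sum_measure_space:
  assumes P: "finite_meas_partition M P"
  shows "(\<Sum>a\<in>P. prob a) = 1"
proof -
  have "(\<Sum>a\<in>P. prob a) = (\<Sum>a\<in>P. prob (a \<inter> space M))"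
    using P by (intro sum.cong) (auto simp: finite_meas_partition_def Int_absorb2 dest: sets.sets_into_space)
  also have "\<dots> = 1" using partition_sum_measure[OF P sets.top] prob_space by simp
  finally show ?thesis .
qed

text \<open>Gibbs' inequality: \<open>ln t \<le> t - 1\<close> is applied to the ratio of the
  product weight to the joint weight. The resulting error terms sum to 1 - 1 = 0, because both
  families of weights are probability vectors.\<close>

lemma part_entropy_refinement_le:
  assumes P: "finite_meas_partition M P" and Q: "finite_meas_partition M Q"
  shows "part_entropy M ((\<lambda>(a, b). a \<inter> b) ` (P \<times> Q)) \<le> part_entropy M P + part_entropy M Q"
proof -
  have fin: "finite P" "finite Q" and meas: "\<And>a. a \<in> P \<Longrightarrow> a \<in> sets M" "\<And>b. b \<in> Q \<Longrightarrow> b \<in> sets M"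
    using P Q by (auto simp: finite_meas_partition_def)
  have disj: "a = a' \<or> a \<inter> a' = {}" if "a \<in> P \<and> a' \<in> P \<or> a \<in> Q \<and> a' \<in> Q" for a a'
  proof -
    have "disjoint P" "disjoint Q" using P Q by (auto simp: finite_meas_partition_def)
    then show ?thesis using that by (auto dest: disjointD)
  qed
  let ?r = "\<lambda>a b. prob (a \<inter> b)"
  have sumQ: "(\<Sum>b\<in>Q. ?r a b) = prob a" if "a \<in> P" for a
    using partition_sum_measure[OF Q meas(1)[OF that]] by (simp add: Int_commute)
  have sumP: "(\<Sum>a\<in>P. ?r a b) = prob b" if "b \<in> Q" for b
    using partition_sum_measure[OF P meas(2)[OF that]] .
  have "part_entropy M ((\<lambda>(a, b). a \<inter> b) ` (P \<times> Q)) =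
      (\<Sum>(a, b)\<in>P \<times> Q. - ?r a b * ln (?r a b))"
    unfolding part_entropy_eq
  proof (subst sum.reindex_nontrivial)
    \<comment> \<open>Distinct pairs can have the same intersection only if it is empty, so merging
      them in the image loses nothing.\<close>
    fix x y assume xy: "x \<in> P \<times> Q" "y \<in> P \<times> Q" "x \<noteq> y" "(\<lambda>(a, b). a \<inter> b) x = (\<lambda>(a, b). a \<inter> b) y"
    obtain a b a' b' where ab: "x = (a, b)" "y = (a', b')" by (metis surj_pair)
    then have eq: "a \<inter> b = a' \<inter> b'" and "a \<inter> a' = {} \<or> b \<inter> b' = {}"
      using xy disj[of a a'] disj[of b b'] by auto
    then have "a \<inter> b = {}" by blast
    then have "(\<lambda>(a, b). a \<inter> b) x = {}" by (simp add: ab)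
    then show "- prob ((\<lambda>(a, b). a \<inter> b) x) * ln (prob ((\<lambda>(a, b). a \<inter> b) x)) = 0" by simp
  qed (use fin in \<open>auto simp: case_prod_beta intro!: sum.cong\<close>)
  also have "\<dots> \<le> (\<Sum>(a, b)\<in>P \<times> Q. - ?r a b * ln (prob a) - ?r a b * ln (prob b) + (prob a * prob b - ?r a b))"
  proof (rule sum_mono, clarify)
    fix a b assume ab: "a \<in> P" "b \<in> Q"
    show "- ?r a b * ln (?r a b) \<le> - ?r a b * ln (prob a) - ?r a b * ln (prob b) + (prob a * prob b - ?r a b)"
    proof (cases "?r a b = 0")
      case False
      then have r: "0 < ?r a b" by (simp add: zero_less_measure_iff)
      have p: "0 < prob a" "0 < prob b"
        using r finite_measure_mono[of "a \<inter> b" a] finite_measure_mono[of "a \<inter> b" b] ab meas by auto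
      have "ln (prob a * prob b / ?r a b) \<le> prob a * prob b / ?r a b - 1"
        using r p by (intro ln_le_minus_one) auto
      then have "ln (prob a) + ln (prob b) - ln (?r a b) \<le> prob a * prob b / ?r a b - 1"
        using r p by (simp add: ln_mult ln_div)
      then have "?r a b * (ln (prob a) + ln (prob b) - ln (?r a b)) \<le> ?r a b * (prob a * prob b / ?r a b - 1)"
        using r by (intro mult_left_mono) auto
      also have "\<dots> = prob a * prob b - ?r a b" using r by (simp add: field_simps)
      finally show ?thesis by (simp add: algebra_simps)
    qed simp
  qed
  also have "\<dots> = (\<Sum>a\<in>P. \<Sum>b\<in>Q. - ?r a b * ln (prob a)) + (\<Sum>b\<in>Q. \<Sum>a\<in>P. - ?r a b * ln (prob b))
      + ((\<Sum>a\<in>P. \<Sum>b\<in>Q. prob a * prob b) - (\<Sum>a\<in>P. \<Sum>b\<in>Q. ?r a b))"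
    by (subst sum.swap[of _ P Q])
      (simp add: sum.cartesian_product[symmetric] sum.distrib sum_subtractf sum_negf)
  also have "(\<Sum>a\<in>P. \<Sum>b\<in>Q. - ?r a b * ln (prob a)) = part_entropy M P"
    unfolding part_entropy_eq by (intro sum.cong refl) (simp add: sum_negf sumQ flip: sum_distrib_right)
  also have "(\<Sum>b\<in>Q. \<Sum>a\<in>P. - ?r a b * ln (prob b)) = part_entropy M Q"
    unfolding part_entropy_eq by (intro sum.cong refl) (simp add: sum_negf sumP flip: sum_distrib_right)
  also have "(\<Sum>a\<in>P. \<Sum>b\<in>Q. prob a * prob b) = 1"
    using partition_sum_measure_space[OF P] partition_sum_measure_space[OF Q]
    by (simp flip: sum_distrib_left)
  also have "(\<Sum>a\<in>P. \<Sum>b\<in>Q. ?r a b) = 1"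
    using partition_sum_measure_space[OF P] by (simp add: sumQ)
  finally show ?thesis by simp
qed

text \<open>Markov's inequality for the information function \<open>- ln (prob a)\<close>, whose
  mean is the entropy: it exceeds \<open>c\<close> only on mass \<open>s\<close>. The remaining
  atoms are few because each has mass at least \<open>exp (- c)\<close>.\<close>

lemma partition_large_atoms:
  assumes Q: "finite_meas_partition M Q" and le: "part_entropy M Q \<le> s * c" and c: "0 < c"
  defines "G \<equiv> {a \<in> Q. exp (- c) \<le> prob a}"
  shows "real (card G) \<le> exp c" and "(\<Sum>a\<in>Q - G. prob a) \<le> s"
proof -
  have fin: "finite Q" using Q by (simp add: finite_meas_partition_def)
  have "real (card G) * exp (- c) = (\<Sum>a\<in>G. exp (- c))" by simp
  also have "\<dots> \<le> (\<Sum>a\<in>G. prob a)" by (intro sum_mono) (simp add: G_def)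
  also have "\<dots> \<le> (\<Sum>a\<in>Q. prob a)" using fin by (intro sum_mono2) (auto simp: G_def)
  finally show "real (card G) \<le> exp c"
    using partition_sum_measure_space[OF Q] by (simp add: exp_minus field_simps)
  have "c * (\<Sum>a\<in>Q - G. prob a) = (\<Sum>a\<in>Q - G. c * prob a)" by (simp add: sum_distrib_left)
  also have "\<dots> \<le> (\<Sum>a\<in>Q - G. - prob a * ln (prob a))"
  proof (rule sum_mono)
    fix a assume a: "a \<in> Q - G"
    show "c * prob a \<le> - prob a * ln (prob a)"
    proof (cases "prob a = 0")
      case False
      then have p: "0 < prob a" by (simp add: zero_less_measure_iff)
      have "prob a < exp (- c)" using a by (auto simp: G_def)
      then have "ln (prob a) < ln (exp (- c))" using p by (subst ln_less_cancel_iff) auto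
      then have "ln (prob a) < - c" by simp
      then have "prob a * c \<le> prob a * (- ln (prob a))" using p by (intro mult_left_mono) auto
      then show ?thesis by (simp add: mult.commute)
    qed simp
  qed
  also have "\<dots> \<le> part_entropy M Q"
    unfolding part_entropy_eq
  proof (rule sum_mono2)
    show "0 \<le> - prob b * ln (prob b)" for b
      using part_entropy_nonneg[of "{b}"] by (simp add: part_entropy_eq)
  qed (use fin in auto)
  also have "\<dots> \<le> c * s" using le by (simp add: mult.commute)
  finally show "(\<Sum>a\<in>Q - G. prob a) \<le> s" using c by simp
qed

end

section \<open>Entropy of joins along orbits of an automorphism\<close>

locale full_automorphism = prob_space M for M :: "'a measure" +
  fixes T :: "'a \<Rightarrow> 'a"
  assumes full: "space M = UNIV" and aut: "is_aut M T"
begin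

lemma bij_iterate: "bij (T ^^ n)"
  using aut by (intro bij_fn) (simp add: is_aut_def full)

lemma measurable_iterate [measurable]: "T ^^ n \<in> measurable M M"
proof (induction n)
  case (Suc n)
  have "T \<in> measurable M M" using aut by (simp add: is_aut_def)
  then show ?case using Suc by (simp add: measurable_comp)
qed simp

lemma distr_iterate: "distr M M (T ^^ n) = M"
proof (induction n)
  case 0
  then show ?case by (simp add: distr_id2 id_def)
next
  case (Suc n)
  have T: "T \<in> measurable M M" "distr M M T = M" using aut by (auto simp: is_aut_def)
  have "distr M M (T ^^ Suc n) = distr (distr M M (T ^^ n)) M T"
    using T by (subst distr_distr) auto
  then show ?case using Suc T(2) by (simp only:)
qed

lemma sets_vimage_iterate: "A \<in> sets M \<Longrightarrow> (T ^^ n) -` A \<in> sets M"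
  using measurable_sets[OF measurable_iterate[of n], of A] by (simp add: full)

lemma prob_vimage_iterate: "A \<in> sets M \<Longrightarrow> prob ((T ^^ n) -` A) = prob A"
  using measure_distr[OF measurable_iterate[of n], of A] by (simp add: full distr_iterate)

text \<open>Only the values below \<open>n\<close> matter, and the extensional functions form a
  finite set when \<open>P\<close> is finite; finiteness of the join comes from this. For
  \<open>n = 0\<close> the join consists of \<open>UNIV\<close> alone.\<close>

lemma part_join_eq: "part_join M T P n = (\<lambda>f. \<Inter>i<n. (T ^^ i) -` f i) ` ({..<n} \<rightarrow>\<^sub>E P)"
proof -
  let ?F = "\<lambda>f. \<Inter>i<n. (T ^^ i) -` f i"
  have "?F f \<in> ?F ` ({..<n} \<rightarrow>\<^sub>E P)" if "\<forall>i<n. f i \<in> P" for f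
    using that by (intro image_eqI[of _ _ "restrict f {..<n}"]) auto
  moreover have "\<forall>i<n. f i \<in> P" if "f \<in> {..<n} \<rightarrow>\<^sub>E P" for f
    using that by auto
  ultimately show ?thesis unfolding part_join_def full Int_UNIV_right by blast
qed

lemma finite_meas_partition_part_join:
  assumes P: "finite_meas_partition M P"
  shows "finite_meas_partition M (part_join M T P n)"
  unfolding finite_meas_partition_def
proof (intro conjI)
  show "finite (part_join M T P n)" using P unfolding part_join_eq
    by (intro finite_imageI finite_PiE) (auto simp: finite_meas_partition_def)
  show "part_join M T P n \<subseteq> sets M"
  proof -
    have "(\<Inter>i<n. (T ^^ i) -` f i) \<in> sets M" if "f \<in> {..<n} \<rightarrow>\<^sub>E P" for f
    proof (cases "n = 0")
      case True
      then show ?thesis using sets.top[of M] by (simp add: full)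
    next
      case False
      have "f i \<in> sets M" if "i < n" for i
        using P \<open>f \<in> _\<close> that by (auto simp: finite_meas_partition_def)
      then show ?thesis using False by (intro sets.finite_INT sets_vimage_iterate) auto
    qed
    then show ?thesis by (auto simp: part_join_eq)
  qed
  have uniq: "p = q" if "p \<in> P" "q \<in> P" "x \<in> p" "x \<in> q" for p q x
    using that P unfolding finite_meas_partition_def disjoint_def by blast
  show "disjoint (part_join M T P n)"
    unfolding disjoint_def
  proof (intro ballI impI)
    fix a b assume "a \<in> part_join M T P n" "b \<in> part_join M T P n" and ne: "a \<noteq> b"
    then obtain f g where f: "f \<in> {..<n} \<rightarrow>\<^sub>E P" "a = (\<Inter>i<n. (T ^^ i) -` f i)"
      and g: "g \<in> {..<n} \<rightarrow>\<^sub>E P" "b = (\<Inter>i<n. (T ^^ i) -` g i)" by (auto simp: part_join_eq)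
    show "a \<inter> b = {}"
    proof (rule ccontr)
      assume "a \<inter> b \<noteq> {}"
      then obtain x where x: "x \<in> a" "x \<in> b" by auto
      have "f i = g i" if "i < n" for i
        using uniq[of "f i" "g i" "(T ^^ i) x"] f g x that by auto
      then have "a = b" using f g by auto
      then show False using ne by simp
    qed
  qed
  show "\<Union> (part_join M T P n) = space M"
  proof -
    have "x \<in> \<Union> (part_join M T P n)" for x
    proof -
      have "\<exists>p\<in>P. y \<in> p" for y using P full unfolding finite_meas_partition_def by blast
      then obtain h where h: "\<And>y. h y \<in> P" "\<And>y. y \<in> h y" by metis
      have "(\<Inter>i<n. (T ^^ i) -` (\<lambda>i\<in>{..<n}. h ((T ^^ i) x)) i) \<in> part_join M T P n"
        unfolding part_join_eq using h by (intro imageI) auto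
      then show ?thesis by (rule UnionI) (use h in auto)
    qed
    then show ?thesis using full by auto
  qed
qed

text \<open>Cutting an itinerary of length \<open>m + n\<close> at time \<open>m\<close> leaves two
  itineraries, the second read from the point \<open>(T ^^ m) x\<close>. With invariance of entropy
  under \<open>T ^^ m\<close> this makes the entropy of the joins subadditive.\<close>

lemma part_join_add:
  "part_join M T P (m + n) =
    (\<lambda>(a, b). a \<inter> b) ` (part_join M T P m \<times> ((-`) (T ^^ m)) ` part_join M T P n)"
proof -
  have split: "(\<Inter>i<m + n. (T ^^ i) -` f i) =
    (\<Inter>i<m. (T ^^ i) -` f i) \<inter> (T ^^ m) -` (\<Inter>i<n. (T ^^ i) -` f (m + i))" for f :: "nat \<Rightarrow> 'a set"
  proof -
    have "(\<forall>i<m + n. Q i) \<longleftrightarrow> (\<forall>i<m. Q i) \<and> (\<forall>i<n. Q (m + i))" for Q :: "nat \<Rightarrow> bool"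
    proof (intro iffI conjI allI impI)
      fix i assume "(\<forall>i<m. Q i) \<and> (\<forall>i<n. Q (m + i))" "i < m + n"
      then show "Q i" by (cases "i < m") (auto dest: spec[of _ "i - m"])
    qed auto
    then have "x \<in> (\<Inter>i<m + n. (T ^^ i) -` f i) \<longleftrightarrow>
      (\<forall>i<m. (T ^^ i) x \<in> f i) \<and> (\<forall>i<n. (T ^^ (m + i)) x \<in> f (m + i))" for x
      unfolding INT_iff vimage_eq Ball_def lessThan_iff .
    moreover have "(T ^^ (m + i)) x = (T ^^ i) ((T ^^ m) x)" for i x
      by (simp add: add.commute[of m] funpow_add)
    ultimately show ?thesis
      by (intro set_eqI) (simp only: Int_iff vimage_eq INT_iff Ball_def lessThan_iff)
  qed
  have "part_join M T P (m + n) = {(\<Inter>i<m. (T ^^ i) -` f i) \<inter> (T ^^ m) -` (\<Inter>i<n. (T ^^ i) -` g i) | f g.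
    (\<forall>i<m. f i \<in> P) \<and> (\<forall>i<n. g i \<in> P)}" (is "_ = ?R")
  proof (intro set_eqI iffI)
    fix a assume "a \<in> part_join M T P (m + n)"
    then obtain f where "a = (\<Inter>i<m + n. (T ^^ i) -` f i)" "\<forall>i<m + n. f i \<in> P"
      by (auto simp: part_join_def full)
    then show "a \<in> ?R" unfolding split
      by (intro CollectI exI[of _ f] exI[of _ "\<lambda>i. f (m + i)"]) auto
  next
    fix a assume "a \<in> ?R"
    then obtain f g where a: "a = (\<Inter>i<m. (T ^^ i) -` f i) \<inter> (T ^^ m) -` (\<Inter>i<n. (T ^^ i) -` g i)"
      "\<forall>i<m. f i \<in> P" "\<forall>i<n. g i \<in> P" by auto
    then show "a \<in> part_join M T P (m + n)" unfolding part_join_def full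
      by (intro CollectI exI[of _ "\<lambda>i. if i < m then f i else g (i - m)"]) (auto simp: split)
  qed
  also have "\<dots> = (\<lambda>(a, b). a \<inter> b) ` (part_join M T P m \<times> ((-`) (T ^^ m)) ` part_join M T P n)"
  proof -
    have *: "part_join M T P k = {\<Inter>i<k. (T ^^ i) -` f i | f. \<forall>i<k. f i \<in> P}" for k
      by (simp add: part_join_def full)
    show ?thesis unfolding * image_def by blast
  qed
  finally show ?thesis .
qed

lemma finite_meas_partition_vimage:
  assumes "finite_meas_partition M P"
  shows "finite_meas_partition M (((-`) (T ^^ m)) ` P)"
proof -
  have fin: "finite P" and sub: "P \<subseteq> sets M" and dis: "disjoint P" and un: "\<Union>P = UNIV"
    using assms full by (auto simp: finite_meas_partition_def)
  have "disjoint (((-`) (T ^^ m)) ` P)"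
    using dis unfolding disjoint_def by auto
  moreover have "\<Union> (((-`) (T ^^ m)) ` P) = UNIV"
    using un by (metis vimage_Union vimage_UNIV)
  ultimately show ?thesis
    using fin sub sets_vimage_iterate by (auto simp: finite_meas_partition_def full)
qed

text \<open>Surjectivity of \<open>T ^^ m\<close> keeps preimages of distinct atoms distinct, so no
  summands merge, and measure preservation keeps each summand.\<close>

lemma part_entropy_vimage:
  assumes P: "finite_meas_partition M P"
  shows "part_entropy M (((-`) (T ^^ m)) ` P) = part_entropy M P"
proof -
  have "inj ((-`) (T ^^ m))"
    using bij_iterate[of m] by (intro injI) (metis bij_betw_def surj_image_vimage_eq)
  then have "inj_on ((-`) (T ^^ m)) P" by (rule inj_on_subset) simp
  then show ?thesis unfolding part_entropy_eq
  proof (subst sum.reindex)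
    have "A \<in> sets M" if "A \<in> P" for A using P that by (auto simp: finite_meas_partition_def)
    then show "sum ((\<lambda>A. - prob A * ln (prob A)) \<circ> (-`) (T ^^ m)) P = (\<Sum>A\<in>P. - prob A * ln (prob A))"
      by (intro sum.cong) (auto simp: prob_vimage_iterate)
  qed
qed

text \<open>The supremum \<open>ks_entropy\<close> bounds the limit from above by 0, and the
  entropies are nonnegative.\<close>

lemma part_entropy_part_join_tendsto_0:
  assumes ks: "ks_entropy M T = 0" and P: "finite_meas_partition M P"
  shows "(\<lambda>n. part_entropy M (part_join M T P n) / real n) \<longlonglongrightarrow> 0"
proof -
  let ?u = "\<lambda>n. part_entropy M (part_join M T P n)"
  note part = finite_meas_partition_part_join[OF P]
  have "?u (m + n) \<le> ?u m + ?u n" for m n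
    unfolding part_join_add
    using part_entropy_refinement_le[OF part finite_meas_partition_vimage[OF part], of m m n]
    by (simp add: part_entropy_vimage[OF part])
  then have conv: "(\<lambda>n. ?u n / real n) \<longlonglongrightarrow> entropy_rel M T P"
    unfolding entropy_rel_def by (intro convergent_LIMSEQ_iff[THEN iffD1] fekete_convergent part_entropy_nonneg)
  have "ereal (entropy_rel M T P) \<le> ks_entropy M T"
    unfolding ks_entropy_def using P by (intro SUP_upper) auto
  then have "entropy_rel M T P \<le> 0" using ks by (simp add: zero_ereal_def)
  moreover have "0 \<le> entropy_rel M T P"
    using conv by (rule LIMSEQ_le_const) (simp add: part_entropy_nonneg)
  ultimately show ?thesis using conv by simp
qed

end

section \<open>Compactness of the space of couplings\<close>

text \<open>A possibly empty atom of the Boolean algebra generated by the sets \<open>A i\<close>,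
  with \<open>s\<close> listing the sets that contain it. Cells make step functions constant and
  also provide refining partitions.\<close>

definition cell :: "'i set \<Rightarrow> ('i \<Rightarrow> 'a set) \<Rightarrow> 'i set \<Rightarrow> 'a set" where
  "cell I A s = {x. \<forall>i\<in>I. x \<in> A i \<longleftrightarrow> i \<in> s}"

lemma sets_cell:
  assumes "finite I" "\<And>i. i \<in> I \<Longrightarrow> A i \<in> sets M" "space M = UNIV"
  shows "cell I A s \<in> sets M"
proof -
  have "{x \<in> space M. \<forall>i\<in>I. x \<in> A i \<longleftrightarrow> i \<in> s} \<in> sets M"
  proof (rule sets.sets_Collect_finite_All[OF _ assms(1)])
    fix i assume "i \<in> I"
    then show "{x \<in> space M. x \<in> A i \<longleftrightarrow> i \<in> s} \<in> sets M"
      using assms(2)[of i] sets.compl_sets[of "A i" M] assms(3)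
      by (cases "i \<in> s") (auto simp: Compl_eq_Diff_UNIV[symmetric] Compl_eq)
  qed
  then show ?thesis by (simp add: cell_def assms(3))
qed

lemma disjoint_family_cell: "disjoint_family_on (cell I A) (Pow I)"
  by (auto simp: disjoint_family_on_def cell_def)

lemma UN_cell:
  assumes "i \<in> I"
  shows "A i = (\<Union>s\<in>{s \<in> Pow I. i \<in> s}. cell I A s)"
proof (intro set_eqI iffI)
  fix x assume "x \<in> A i"
  then have "x \<in> cell I A {i \<in> I. x \<in> A i}" "{i \<in> I. x \<in> A i} \<in> {s \<in> Pow I. i \<in> s}"
    using assms by (auto simp: cell_def)
  then show "x \<in> (\<Union>s\<in>{s \<in> Pow I. i \<in> s}. cell I A s)" by blast
qed (use assms in \<open>auto simp: cell_def\<close>)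

section \<open>Regular measures and finitely additive bimeasures\<close>

locale borel_prob_space = prob_space M for M :: "'a::polish_space measure" +
  assumes full: "space M = UNIV" and borel: "sets M = sets borel"
begin

lemma inner_compact:
  assumes A: "A \<in> sets M" and d: "0 < (d::real)"
  obtains K where "compact K" "K \<subseteq> A" "K \<in> sets M" "prob A < prob K + d"
\<comment> \<open>\<open>ennreal\<close> truncates negative numbers, so \<open>prob A - d\<close> is
  passed to it only when it is nonnegative; otherwise the empty set is close enough.\<close>
proof (cases "prob A < d")
  case True
  then show ?thesis using that[of "{}"] by simp
next
  case False
  have "ennreal (prob A - d) < emeasure M A"
    using False d by (simp add: emeasure_eq_measure ennreal_less_iff)
  also have "emeasure M A = (SUP K\<in>{K. K \<subseteq> A \<and> compact K}. emeasure M K)"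
    using A by (intro inner_regular) (auto simp: borel emeasure_eq_measure)
  finally obtain K where K: "K \<subseteq> A" "compact K" "ennreal (prob A - d) < emeasure M K"
    by (auto simp: less_SUP_iff)
  then have "prob A - d < prob K"
    using False by (simp add: emeasure_eq_measure ennreal_less_iff)
  then show ?thesis using that[of K] K by (simp add: borel borel_compact)
qed

lemma outer_open:
  assumes A: "A \<in> sets M" and d: "0 < (d::real)"
  obtains U where "open U" "A \<subseteq> U" "U \<in> sets M" "prob U < prob A + d"
proof -
  have "emeasure M A = (INF U\<in>{U. A \<subseteq> U \<and> open U}. emeasure M U)"
    using A by (intro outer_regular) (auto simp: borel emeasure_eq_measure)
  moreover have "emeasure M A < ennreal (prob A + d)"
    using d by (simp add: emeasure_eq_measure ennreal_less_iff)
  ultimately obtain U where U: "A \<subseteq> U" "open U" "emeasure M U < ennreal (prob A + d)"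
    by (auto simp: INF_less_iff)
  then have "prob U < prob A + d"
    by (simp add: emeasure_eq_measure ennreal_less_iff)
  then show ?thesis using that[of U] U by (simp add: borel)
qed

end

text \<open>These are the relations between rectangle masses that survive pointwise limits.
  Countable additivity is not among them and has to be recovered from the marginals, which are
  genuine regular measures.\<close>

locale bimeasure = borel_prob_space M for M :: "'a::polish_space measure" +
  fixes g :: "'a set \<Rightarrow> 'a set \<Rightarrow> real"
  assumes nonneg: "A \<in> sets M \<Longrightarrow> B \<in> sets M \<Longrightarrow> 0 \<le> g A B"
    and add_left: "A \<in> sets M \<Longrightarrow> A' \<in> sets M \<Longrightarrow> B \<in> sets M \<Longrightarrow> A \<inter> A' = {} \<Longrightarrow> g (A \<union> A') B = g A B + g A' B"
    and add_right: "A \<in> sets M \<Longrightarrow> B \<in> sets M \<Longrightarrow> B' \<in> sets M \<Longrightarrow> B \<inter> B' = {} \<Longrightarrow> g A (B \<union> B') = g A B + g A B'"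
    and marginal_left: "A \<in> sets M \<Longrightarrow> g A UNIV = prob A"
    and marginal_right: "B \<in> sets M \<Longrightarrow> g UNIV B = prob B"
begin

lemma empty_left [simp]: "B \<in> sets M \<Longrightarrow> g {} B = 0"
  using add_left[of "{}" "{}" B] by simp

lemma empty_right [simp]: "A \<in> sets M \<Longrightarrow> g A {} = 0"
  using add_right[of A "{}" "{}"] by simp

lemma UNIV_sets [simp]: "UNIV \<in> sets M"
  using sets.top[of M] by (simp add: full)

lemma diff_left: "A \<in> sets M \<Longrightarrow> A' \<in> sets M \<Longrightarrow> B \<in> sets M \<Longrightarrow> A' \<subseteq> A \<Longrightarrow> g A B = g A' B + g (A - A') B"
  using add_left[of A' "A - A'" B] by (simp add: Un_absorb1)

lemma diff_right: "A \<in> sets M \<Longrightarrow> B \<in> sets M \<Longrightarrow> B' \<in> sets M \<Longrightarrow> B' \<subseteq> B \<Longrightarrow> g A B = g A B' + g A (B - B')"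
  using add_right[of A B' "B - B'"] by (simp add: Un_absorb1)

lemma le_left: "A \<in> sets M \<Longrightarrow> B \<in> sets M \<Longrightarrow> g A B \<le> prob A"
  using diff_right[of A UNIV B] nonneg[of A "UNIV - B"] marginal_left[of A] by (simp add: sets.Diff)

lemma le_right: "A \<in> sets M \<Longrightarrow> B \<in> sets M \<Longrightarrow> g A B \<le> prob B"
  using diff_left[of UNIV A B] nonneg[of "UNIV - A" B] marginal_right[of B] by (simp add: sets.Diff)

text \<open>The loss is controlled by the marginals alone, so approximating the sides with respect
  to \<open>M\<close> approximates the rectangle with respect to \<open>g\<close>. This is how
  regularity passes from \<open>M\<close> to \<open>g\<close>.\<close>

lemma shrink_le:
  assumes "A \<in> sets M" "A' \<in> sets M" "B \<in> sets M" "B' \<in> sets M" "A' \<subseteq> A" "B' \<subseteq> B"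
  shows "g A B \<le> g A' B' + (prob A - prob A') + (prob B - prob B')"
proof -
  have "g A B = g A' B + g (A - A') B" using assms by (intro diff_left) auto
  also have "g (A - A') B \<le> prob A - prob A'"
    using assms le_left[of "A - A'" B] by (simp add: finite_measure_Diff)
  also have "g A' B = g A' B' + g A' (B - B')" using assms by (intro diff_right) auto
  also have "g A' (B - B') \<le> prob B - prob B'"
    using assms le_right[of A' "B - B'"] by (simp add: finite_measure_Diff)
  finally show ?thesis by simp
qed

lemma UN_left:
  assumes "finite S" "\<And>s. s \<in> S \<Longrightarrow> C s \<in> sets M" "disjoint_family_on C S" "B \<in> sets M"
  shows "g (\<Union>s\<in>S. C s) B = (\<Sum>s\<in>S. g (C s) B)"
  using assms
proof (induction S rule: finite_induct)
  case (insert s S)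
  have "C s \<inter> (\<Union>s\<in>S. C s) = {}"
    using insert by (force simp: disjoint_family_on_def)
  moreover have "disjoint_family_on C S"
    using insert.prems by (auto simp: disjoint_family_on_def)
  ultimately show ?case using insert by (simp add: add_left sets.finite_UN)
qed simp

lemma UN_right:
  assumes "finite S" "\<And>s. s \<in> S \<Longrightarrow> C s \<in> sets M" "disjoint_family_on C S" "A \<in> sets M"
  shows "g A (\<Union>s\<in>S. C s) = (\<Sum>s\<in>S. g A (C s))"
  using assms
proof (induction S rule: finite_induct)
  case (insert s S)
  have "C s \<inter> (\<Union>s\<in>S. C s) = {}"
    using insert by (force simp: disjoint_family_on_def)
  moreover have "disjoint_family_on C S"
    using insert.prems by (auto simp: disjoint_family_on_def)
  ultimately show ?case using insert by (simp add: add_right sets.finite_UN)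
qed simp

text \<open>Positivity of the finitely additive integral for possibly overlapping rectangles. On a
  product of a cell of the \<open>A i\<close> and a cell of the \<open>B i\<close> the step function
  is constant, so the sum regroups into cell masses times values of the function.\<close>

lemma simple_function_nonneg:
  fixes c :: "'i \<Rightarrow> real"
  assumes I: "finite I" and A: "\<And>i. i \<in> I \<Longrightarrow> A i \<in> sets M" and B: "\<And>i. i \<in> I \<Longrightarrow> B i \<in> sets M"
    and pos: "\<And>x y. 0 \<le> (\<Sum>i\<in>I. c i * indicator (A i \<times> B i) (x, y))"
  shows "0 \<le> (\<Sum>i\<in>I. c i * g (A i) (B i))"
proof -
  have cells [simp]: "cell I A s \<in> sets M" "cell I B s \<in> sets M" for s
    using I A B full by (auto intro: sets_cell)
  have disj: "disjoint_family_on (cell I C) {s \<in> Pow I. i \<in> s}" for C :: "'i \<Rightarrow> 'a set" and i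
    using disjoint_family_cell by (rule disjoint_family_on_mono[rotated]) auto
  let ?w = "\<lambda>s t. g (cell I A s) (cell I B t)"
  have "g (A i) (B i) = (\<Sum>s\<in>Pow I. \<Sum>t\<in>Pow I. if i \<in> s \<and> i \<in> t then ?w s t else 0)" if i: "i \<in> I" for i
  proof -
    have "g (A i) (B i) = (\<Sum>s\<in>{s \<in> Pow I. i \<in> s}. g (cell I A s) (B i))"
      unfolding UN_cell[OF i, of A] using I B i disj by (intro UN_left) auto
    also have "\<dots> = (\<Sum>s\<in>{s \<in> Pow I. i \<in> s}. \<Sum>t\<in>{t \<in> Pow I. i \<in> t}. ?w s t)"
      unfolding UN_cell[OF i, of B] using I disj by (intro sum.cong UN_right) auto
    also have "\<dots> = (\<Sum>s\<in>Pow I. \<Sum>t\<in>Pow I. if i \<in> s \<and> i \<in> t then ?w s t else 0)"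
    proof -
      have "(\<Sum>t\<in>Pow I. if i \<in> s \<and> i \<in> t then ?w s t else 0) =
          (if i \<in> s then \<Sum>t\<in>{t \<in> Pow I. i \<in> t}. ?w s t else 0)" for s
        using I by (subst sum.inter_filter) auto
      then show ?thesis using I by (subst sum.inter_filter) auto
    qed
    finally show ?thesis .
  qed
  then have "(\<Sum>i\<in>I. c i * g (A i) (B i))
      = (\<Sum>i\<in>I. \<Sum>s\<in>Pow I. \<Sum>t\<in>Pow I. ?w s t * (if i \<in> s \<and> i \<in> t then c i else 0))"
    by (auto intro!: sum.cong simp: sum_distrib_left if_distrib mult.commute cong: if_cong)
  also have "\<dots> = (\<Sum>s\<in>Pow I. \<Sum>i\<in>I. \<Sum>t\<in>Pow I. ?w s t * (if i \<in> s \<and> i \<in> t then c i else 0))"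
    by (rule sum.swap)
  also have "\<dots> = (\<Sum>s\<in>Pow I. \<Sum>t\<in>Pow I. \<Sum>i\<in>I. ?w s t * (if i \<in> s \<and> i \<in> t then c i else 0))"
    by (intro sum.cong refl sum.swap)
  also have "\<dots> = (\<Sum>s\<in>Pow I. \<Sum>t\<in>Pow I. ?w s t * (\<Sum>i\<in>I. if i \<in> s \<and> i \<in> t then c i else 0))"
    by (simp add: sum_distrib_left)
  also have "0 \<le> \<dots>"
  proof (intro sum_nonneg)
    fix s t assume "s \<in> Pow I" "t \<in> Pow I"
    show "0 \<le> ?w s t * (\<Sum>i\<in>I. if i \<in> s \<and> i \<in> t then c i else 0)"
    \<comment> \<open>An empty cell has no point at which to use \<open>pos\<close>, but then the
      mass is 0.\<close>
    proof (cases "cell I A s = {} \<or> cell I B t = {}")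
      case False
      then obtain x y where xy: "x \<in> cell I A s" "y \<in> cell I B t" by auto
      have "(\<Sum>i\<in>I. if i \<in> s \<and> i \<in> t then c i else 0) = (\<Sum>i\<in>I. c i * indicator (A i \<times> B i) (x, y))"
        using xy by (intro sum.cong) (auto simp: cell_def indicator_def)
      then show ?thesis using pos[of x y] nonneg by simp
    qed auto
  qed
  finally show ?thesis .
qed

text \<open>Both bounds express positivity of a difference between the indicator of
  \<open>C \<times> D\<close> and the sum of the other indicators. The option type adds the index
  \<open>None\<close> for \<open>C \<times> D\<close>, and the coefficient pairs (1, -1) and (-1, 1)
  give the two directions.\<close>

lemma sum_rectangles:
  assumes I: "finite I" and AB: "\<And>i. i \<in> I \<Longrightarrow> A i \<in> sets M" "\<And>i. i \<in> I \<Longrightarrow> B i \<in> sets M"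
    and C: "C \<in> sets M" "D \<in> sets M"
  shows sum_rectangles_le: "disjoint_family_on (\<lambda>i. A i \<times> B i) I \<Longrightarrow> (\<Union>i\<in>I. A i \<times> B i) \<subseteq> C \<times> D \<Longrightarrow>
      (\<Sum>i\<in>I. g (A i) (B i)) \<le> g C D"
    and sum_rectangles_ge: "C \<times> D \<subseteq> (\<Union>i\<in>I. A i \<times> B i) \<Longrightarrow> g C D \<le> (\<Sum>i\<in>I. g (A i) (B i))"
proof -
  have key: "0 \<le> c * g C D + (\<Sum>i\<in>I. c' * g (A i) (B i))"
    if pos: "\<And>z. 0 \<le> c * indicator (C \<times> D) z + (\<Sum>i\<in>I. c' * indicator (A i \<times> B i) z)" for c c'
  proof -
    let ?A = "case_option C A" and ?B = "case_option D B" and ?c = "case_option c (\<lambda>_. c')"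
    let ?I = "insert None (Some ` I)"
    have split: "(\<Sum>i\<in>?I. f i) = f None + (\<Sum>i\<in>I. f (Some i))" for f :: "'b option \<Rightarrow> real"
      using I by (simp add: sum.reindex)
    have "0 \<le> (\<Sum>i\<in>?I. ?c i * g (?A i) (?B i))"
    proof (rule simple_function_nonneg)
      fix x y
      show "0 \<le> (\<Sum>i\<in>?I. ?c i * indicator (?A i \<times> ?B i) (x, y))"
        using pos[of "(x, y)"] by (simp only: split option.case)
    qed (use I AB C in auto)
    then show ?thesis by (simp only: split option.case)
  qed
  {
    assume d: "disjoint_family_on (\<lambda>i. A i \<times> B i) I" "(\<Union>i\<in>I. A i \<times> B i) \<subseteq> C \<times> D"
    have "(\<Sum>i\<in>I. indicator (A i \<times> B i) z) \<le> (indicator (C \<times> D) z :: real)" for z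
      using d by (subst indicator_UN_disjoint[OF I, symmetric]) (auto intro!: indicator_leI)
    then show "(\<Sum>i\<in>I. g (A i) (B i)) \<le> g C D"
      using key[of 1 "-1"] by (simp add: sum_negf)
  }
  assume cov: "C \<times> D \<subseteq> (\<Union>i\<in>I. A i \<times> B i)"
  have "(indicator (C \<times> D) z :: real) \<le> (\<Sum>i\<in>I. indicator (A i \<times> B i) z)" for z
  proof (cases "z \<in> C \<times> D")
    case True
    then obtain i where i: "i \<in> I" "z \<in> A i \<times> B i" using cov by blast
    have "(indicator (A i \<times> B i) z :: real) \<le> (\<Sum>i\<in>I. indicator (A i \<times> B i) z)"
      using I i by (intro member_le_sum) auto
    then show ?thesis using i True by simp
  qed (simp add: sum_nonneg)
  then show "g C D \<le> (\<Sum>i\<in>I. g (A i) (B i))"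
    using key[of "-1" 1] by simp
qed

text \<open>Compactness replaces continuity: a compact rectangle inside \<open>C \<times> D\<close>
  is covered by slightly larger open rectangles, and a finite subcover reduces the claim to
  \<open>sum_rectangles_ge\<close>.\<close>

lemma countably_subadditive_rectangles:
  fixes A B :: "nat \<Rightarrow> 'a set"
  assumes AB: "\<And>n. A n \<in> sets M" "\<And>n. B n \<in> sets M" and C: "C \<in> sets M" "D \<in> sets M"
    and cov: "C \<times> D \<subseteq> (\<Union>n. A n \<times> B n)" and summ: "summable (\<lambda>n. g (A n) (B n))"
  shows "g C D \<le> (\<Sum>n. g (A n) (B n))"
proof (rule field_le_epsilon)
  fix e :: real assume e: "0 < e"
  \<comment> \<open>Shrinking \<open>C\<close> and \<open>D\<close> costs \<open>2 * d\<close>;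
    enlarging all \<open>A n\<close> and \<open>B n\<close> costs twice the sum of the
    \<open>h n\<close>, again at most \<open>2 * d\<close>.\<close>
  define d where "d = e / 4"
  have d: "0 < d" using e by (simp add: d_def)
  obtain K where K: "compact K" "K \<subseteq> C" "K \<in> sets M" "prob C < prob K + d"
    using inner_compact[OF C(1) d] by blast
  obtain L where L: "compact L" "L \<subseteq> D" "L \<in> sets M" "prob D < prob L + d"
    using inner_compact[OF C(2) d] by blast
  define h where "h n = d * (1/2) ^ Suc n" for n :: nat
  have h: "0 < h n" for n using d by (simp add: h_def)
  have h_sums: "h sums d"
    unfolding h_def using sums_mult[OF power_half_series, of d] by simp
  have "\<exists>U. open U \<and> A n \<subseteq> U \<and> U \<in> sets M \<and> prob U < prob (A n) + h n" for n
    using outer_open[OF AB(1)[of n] h[of n]] by metis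
  then obtain U where U: "\<And>n. open (U n)" "\<And>n. A n \<subseteq> U n" "\<And>n. U n \<in> sets M" "\<And>n. prob (U n) < prob (A n) + h n"
    by metis
  have "\<exists>U. open U \<and> B n \<subseteq> U \<and> U \<in> sets M \<and> prob U < prob (B n) + h n" for n
    using outer_open[OF AB(2)[of n] h[of n]] by metis
  then obtain V where V: "\<And>n. open (V n)" "\<And>n. B n \<subseteq> V n" "\<And>n. V n \<in> sets M" "\<And>n. prob (V n) < prob (B n) + h n"
    by metis
  have "K \<times> L \<subseteq> (\<Union>n. A n \<times> B n)" using K(2) L(2) cov by blast
  also have "\<dots> \<subseteq> (\<Union>n\<in>UNIV. U n \<times> V n)" using U(2) V(2) by blast
  finally have "K \<times> L \<subseteq> (\<Union>n\<in>UNIV. U n \<times> V n)" .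
  then obtain N where N: "finite N" "K \<times> L \<subseteq> (\<Union>n\<in>N. U n \<times> V n)"
    by (rule compactE_image[OF compact_Times[OF K(1) L(1)], of UNIV "\<lambda>n. U n \<times> V n", rotated])
      (auto intro: open_Times U(1) V(1))
  have "g C D \<le> g K L + (prob C - prob K) + (prob D - prob L)"
    using C K L by (intro shrink_le) auto
  also have "\<dots> \<le> g K L + 2 * d" using K L by simp
  also have "g K L \<le> (\<Sum>n\<in>N. g (U n) (V n))"
    using N K L U V by (intro sum_rectangles_ge) auto
  also have "\<dots> \<le> (\<Sum>n\<in>N. g (A n) (B n) + 2 * h n)"
  proof (rule sum_mono)
    fix n
    have "g (U n) (V n) \<le> g (A n) (B n) + (prob (U n) - prob (A n)) + (prob (V n) - prob (B n))"
      using U V AB by (intro shrink_le) auto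
    then show "g (U n) (V n) \<le> g (A n) (B n) + 2 * h n" using U(4)[of n] V(4)[of n] by simp
  qed
  also have "\<dots> = (\<Sum>n\<in>N. g (A n) (B n)) + 2 * (\<Sum>n\<in>N. h n)"
    by (simp add: sum.distrib sum_distrib_left)
  also have "(\<Sum>n\<in>N. g (A n) (B n)) \<le> (\<Sum>n. g (A n) (B n))"
    using summ N AB by (intro sum_le_suminf) (auto intro: nonneg)
  also have "(\<Sum>n\<in>N. h n) \<le> d"
    using sum_le_suminf[of h N] h_sums N h by (auto simp: sums_iff less_imp_le)
  finally show "g C D \<le> (\<Sum>n. g (A n) (B n)) + e" by (simp add: d_def)
qed

lemma rectangles_sums:
  fixes A B :: "nat \<Rightarrow> 'a set"
  assumes AB: "\<And>n. A n \<in> sets M" "\<And>n. B n \<in> sets M" and C: "C \<in> sets M" "D \<in> sets M"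
    and disj: "disjoint_family (\<lambda>n. A n \<times> B n)" and un: "(\<Union>n. A n \<times> B n) = C \<times> D"
  shows "(\<lambda>n. g (A n) (B n)) sums g C D"
proof -
  have le: "(\<Sum>n<k. g (A n) (B n)) \<le> g C D" for k
  proof (rule sum_rectangles_le)
    show "disjoint_family_on (\<lambda>n. A n \<times> B n) {..<k}"
      using disj by (rule disjoint_family_on_mono[rotated]) simp
    show "(\<Union>n<k. A n \<times> B n) \<subseteq> C \<times> D" unfolding un[symmetric] by blast
  qed (use AB C in auto)
  have summ: "summable (\<lambda>n. g (A n) (B n))"
    using AB le by (intro summableI_nonneg_bounded nonneg) auto
  have "(\<Sum>n. g (A n) (B n)) \<le> g C D"
    using summ le by (intro suminf_le_const) auto
  moreover have "g C D \<le> (\<Sum>n. g (A n) (B n))"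
    using AB C un summ by (intro countably_subadditive_rectangles) auto
  ultimately show ?thesis using summ by (simp add: sums_iff)
qed

lemma rectangle_semiring: "semiring_of_sets UNIV {a \<times> b | a b. a \<in> sets M \<and> b \<in> sets M}"
proof (unfold_locales)
  let ?R = "{a \<times> b | a b. a \<in> sets M \<and> b \<in> sets M}"
  show "{} \<in> ?R" by blast
  fix x y assume "x \<in> ?R" "y \<in> ?R"
  then obtain a b c d where xy: "x = a \<times> b" "y = c \<times> d"
    and m: "a \<in> sets M" "b \<in> sets M" "c \<in> sets M" "d \<in> sets M" by blast
  show "x \<inter> y \<in> ?R" using m unfolding xy Times_Int_Times by blast
  have "x - y = \<Union>{(a - c) \<times> b, (a \<inter> c) \<times> (b - d)}" unfolding xy by auto
  moreover have "disjoint {(a - c) \<times> b, (a \<inter> c) \<times> (b - d)}" by (auto simp: disjoint_def)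
  moreover have "(a - c) \<times> b \<in> ?R" "(a \<inter> c) \<times> (b - d) \<in> ?R" using m by blast+
  ultimately show "\<exists>C\<subseteq>?R. finite C \<and> disjoint C \<and> x - y = \<Union>C"
    by (intro exI[of _ "{(a - c) \<times> b, (a \<inter> c) \<times> (b - d)}"]) auto
qed auto

text \<open>Caratheodory's extension from the semiring of rectangles, with
  \<open>rectangles_sums\<close> as the premeasure property.\<close>

lemma extends_to_coupling:
  "\<exists>\<rho>\<in>C2 M. \<forall>A\<in>sets M. \<forall>B\<in>sets M. measure \<rho> (A \<times> B) = g A B"
proof -
  let ?P = "\<lambda>A B. A \<in> sets M \<and> B \<in> sets M"
  define \<rho> where "\<rho> = extend_measure UNIV {(A, B). ?P A B} (\<lambda>(A, B). A \<times> B) (\<lambda>(A, B). ennreal (g A B))"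
  have rect: "emeasure \<rho> (A \<times> B) = ennreal (g A B)" if "?P A B" for A B
  proof (rule extend_measure_caratheodory_pair[where P="?P", OF \<rho>_def that rectangle_semiring])
    fix A B C D assume *: "?P A B" "?P C D" "A \<times> B = C \<times> D"
    \<comment> \<open>A nonempty rectangle determines its sides, and \<open>g\<close> vanishes on
      the empty ones, so the premeasure is well defined.\<close>
    have "A = C \<and> B = D \<or> ((A = {} \<or> B = {}) \<and> (C = {} \<or> D = {}))" using *(3) by (metis times_eq_iff)
    then show "ennreal (g A B) = ennreal (g C D)" using * by auto
  next
    fix A B :: "nat \<Rightarrow> 'a set" and C D
    assume "\<And>n. ?P (A n) (B n)" "?P C D" "disjoint_family (\<lambda>n. A n \<times> B n)" "(\<Union>n. A n \<times> B n) = C \<times> D"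
    then show "(\<Sum>n. ennreal (g (A n) (B n))) = ennreal (g C D)"
      by (intro suminf_ennreal_eq rectangles_sums nonneg) auto
  qed auto
  have eq: "(\<lambda>(A, B). A \<times> B) ` {(A, B). ?P A B} = {A \<times> B | A B. ?P A B}" by auto
  have sets: "sets \<rho> = sets (M \<Otimes>\<^sub>M M)"
    unfolding \<rho>_def by (subst sets_extend_measure) (simp_all only: eq sets_pair_measure full UNIV_Times_UNIV Pow_UNIV subset_UNIV)
  have space: "space \<rho> = UNIV" using sets_eq_imp_space_eq[OF sets] by (simp add: space_pair_measure full)
  have fst: "fst \<in> measurable \<rho> M" and snd: "snd \<in> measurable \<rho> M"
    using measurable_cong_sets[OF sets refl, of M] by auto
  have "emeasure \<rho> (UNIV \<times> UNIV) = 1"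
    using rect[of UNIV UNIV] marginal_left[of UNIV] prob_space by (simp add: full)
  then have "prob_space \<rho>" by (intro prob_spaceI) (simp add: space)
  moreover have "distr \<rho> M fst = M"
  proof (rule measure_eqI)
    fix A assume "A \<in> sets (distr \<rho> M fst)"
    then have A: "A \<in> sets M" by simp
    have "fst -` A = A \<times> (UNIV :: 'a set)" by auto
    then show "emeasure (distr \<rho> M fst) A = emeasure M A"
      using A fst rect[of A UNIV] by (simp add: emeasure_distr space marginal_left emeasure_eq_measure)
  qed simp
  moreover have "distr \<rho> M snd = M"
  proof (rule measure_eqI)
    fix A assume "A \<in> sets (distr \<rho> M snd)"
    then have A: "A \<in> sets M" by simp
    have "snd -` A = (UNIV :: 'a set) \<times> A" by auto
    then show "emeasure (distr \<rho> M snd) A = emeasure M A"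
      using A snd rect[of UNIV A] by (simp add: emeasure_distr space marginal_right emeasure_eq_measure)
  qed simp
  ultimately have "\<rho> \<in> C2 M" by (simp add: C2_def sets)
  moreover have "measure \<rho> (A \<times> B) = g A B" if "?P A B" for A B
    using rect[OF that] that nonneg by (simp add: measure_def)
  ultimately show ?thesis by blast
qed

end

section \<open>The topology on the set of couplings\<close>

context borel_prob_space
begin

lemma C2D:
  assumes "\<rho> \<in> C2 M"
  shows "sets \<rho> = sets (M \<Otimes>\<^sub>M M)" "prob_space \<rho>" "space \<rho> = UNIV"
    and "\<And>A B. A \<in> sets M \<Longrightarrow> B \<in> sets M \<Longrightarrow> A \<times> B \<in> sets \<rho>"
    and "\<And>A. A \<in> sets M \<Longrightarrow> measure \<rho> (A \<times> UNIV) = prob A"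
    and "\<And>A. A \<in> sets M \<Longrightarrow> measure \<rho> (UNIV \<times> A) = prob A"
proof -
  show s: "sets \<rho> = sets (M \<Otimes>\<^sub>M M)" and "prob_space \<rho>" using assms by (auto simp: C2_def)
  show sp: "space \<rho> = UNIV" using sets_eq_imp_space_eq[OF s] by (simp add: space_pair_measure full)
  show "A \<times> B \<in> sets \<rho>" if "A \<in> sets M" "B \<in> sets M" for A B using that by (simp add: s)
  have fst: "fst \<in> measurable \<rho> M" and snd: "snd \<in> measurable \<rho> M"
    using measurable_cong_sets[OF s refl, of M] by auto
  fix A assume A: "A \<in> sets M"
  have "fst -` A = A \<times> (UNIV :: 'a set)" "snd -` A = (UNIV :: 'a set) \<times> A" by auto
  then show "measure \<rho> (A \<times> UNIV) = prob A" "measure \<rho> (UNIV \<times> A) = prob A"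
    using measure_distr[OF fst A] measure_distr[OF snd A] assms sp by (auto simp: C2_def)
qed

lemma C2_eqI:
  assumes \<rho>: "\<rho> \<in> C2 M" "\<rho>' \<in> C2 M"
    and eq: "\<And>A B. A \<in> sets M \<Longrightarrow> B \<in> sets M \<Longrightarrow> measure \<rho> (A \<times> B) = measure \<rho>' (A \<times> B)"
  shows "\<rho> = \<rho>'"
proof -
  interpret r: prob_space \<rho> by (rule C2D(2)[OF \<rho>(1)])
  interpret r': prob_space \<rho>' by (rule C2D(2)[OF \<rho>(2)])
  have UN: "UNIV \<in> sets M" using sets.top[of M] by (simp add: full)
  show ?thesis
  proof (rule measure_eqI_generator_eq[OF Int_stable_pair_measure_generator[of M M], where A="\<lambda>_. UNIV" and \<Omega>=UNIV])
    show "range (\<lambda>_. UNIV) \<subseteq> {a \<times> b | a b. a \<in> sets M \<and> b \<in> sets M}"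
      using UN by (auto intro!: exI[of _ UNIV])
  qed (auto simp: C2D[OF \<rho>(1)] C2D[OF \<rho>(2)] sets_pair_measure full r.emeasure_eq_measure r'.emeasure_eq_measure eq)
qed

lemma topspace_C2_topology: "topspace (C2_topology M) = C2 M"
proof -
  have "C2 M \<in> {{\<rho>\<in>C2 M. measure \<rho> (A \<times> B) \<in> W} | A B W. A \<in> sets M \<and> B \<in> sets M \<and> open W}"
    by (intro CollectI exI[of _ "{}"] exI[of _ UNIV]) auto
  then show ?thesis unfolding C2_topology_def topology_generated_by_topspace by blast
qed

lemma openin_C2_topology_rectangle:
  "A \<in> sets M \<Longrightarrow> B \<in> sets M \<Longrightarrow> open W \<Longrightarrow> openin (C2_topology M) {\<rho>\<in>C2 M. measure \<rho> (A \<times> B) \<in> W}"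
  unfolding C2_topology_def by (intro topology_generated_by_Basis) blast

lemma bimeasure_C2:
  assumes \<rho>: "\<rho> \<in> C2 M"
  shows "bimeasure M (\<lambda>A B. measure \<rho> (A \<times> B))"
proof
  interpret r: prob_space \<rho> by (rule C2D(2)[OF \<rho>])
  note m = C2D[OF \<rho>]
  fix A A' B assume s: "A \<in> sets M" "A' \<in> sets M" "B \<in> sets M" and d: "A \<inter> A' = {}"
  have "measure \<rho> (A \<times> B \<union> A' \<times> B) = measure \<rho> (A \<times> B) + measure \<rho> (A' \<times> B)"
    using m(4) s d by (intro r.finite_measure_Union) auto
  then show "measure \<rho> ((A \<union> A') \<times> B) = measure \<rho> (A \<times> B) + measure \<rho> (A' \<times> B)"
    by (simp add: Sigma_Un_distrib1)
  have "measure \<rho> (B \<times> A \<union> B \<times> A') = measure \<rho> (B \<times> A) + measure \<rho> (B \<times> A')"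
    using m(4) s d by (intro r.finite_measure_Union) auto
  then show "measure \<rho> (B \<times> (A \<union> A')) = measure \<rho> (B \<times> A) + measure \<rho> (B \<times> A')"
    by (simp add: Sigma_Un_distrib2)
qed (auto simp: C2D[OF \<rho>])

text \<open>The couplings are the continuous image of a closed subset of a Tychonoff cube: the finitely
  additive bimeasures with marginals \<open>M\<close>, all of which extend to measures by regularity of \<open>M\<close>.\<close>

lemma compact_space_C2: "compact_space (C2_topology M)"
proof -
  define K :: "('a set \<times> 'a set \<Rightarrow> real) set" where
    "K = {g. (\<forall>A B. A \<in> sets M \<longrightarrow> B \<in> sets M \<longrightarrow> 0 \<le> g (A, B)) \<and>
      (\<forall>A A' B. A \<in> sets M \<longrightarrow> A' \<in> sets M \<longrightarrow> B \<in> sets M \<longrightarrow> A \<inter> A' = {} \<longrightarrow> g (A \<union> A', B) = g (A, B) + g (A', B)) \<and>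
      (\<forall>A B B'. A \<in> sets M \<longrightarrow> B \<in> sets M \<longrightarrow> B' \<in> sets M \<longrightarrow> B \<inter> B' = {} \<longrightarrow> g (A, B \<union> B') = g (A, B) + g (A, B')) \<and>
      (\<forall>A. A \<in> sets M \<longrightarrow> g (A, UNIV) = prob A) \<and> (\<forall>B. B \<in> sets M \<longrightarrow> g (UNIV, B) = prob B)}"
  \<comment> \<open>Coordinates are indexed by all pairs of sets. \<open>K\<close> constrains only
    the measurable ones; the cube bounds the others too, so Tychonoff's theorem applies.\<close>
  define Q :: "('a set \<times> 'a set \<Rightarrow> real) set" where "Q = PiE UNIV (\<lambda>_. {0..1})"
  have closed_const: "closed {x :: 'a set \<times> 'a set \<Rightarrow> real. P \<longrightarrow> R x}" if "closed {x. R x}" for P R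
    using that by (cases P) auto
  have "closed K" unfolding K_def
    by (intro closed_Collect_conj closed_Collect_all closed_const closed_Collect_eq closed_Collect_le
        continuous_intros continuous_on_product_coordinates)
  moreover have "compact Q"
    using compactin_PiE[of "\<lambda>_. euclideanreal" UNIV "\<lambda>_::'a set \<times> 'a set. {0..1::real}"]
    unfolding Q_def by (simp add: euclidean_product_topology)
  ultimately have comp: "compactin euclidean (K \<inter> Q)" by (simp add: closed_Int_compact)
  \<comment> \<open>The choice is harmless: by \<open>C2_eqI\<close> the rectangle masses determine
    the coupling. Hence a subbasic open set pulls back to a condition on one coordinate.\<close>
  define \<Psi> where "\<Psi> g = (SOME \<rho>. \<rho> \<in> C2 M \<and> (\<forall>A\<in>sets M. \<forall>B\<in>sets M. measure \<rho> (A \<times> B) = g (A, B)))"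
    for g :: "'a set \<times> 'a set \<Rightarrow> real"
  have \<Psi>: "\<Psi> g \<in> C2 M" "\<And>A B. A \<in> sets M \<Longrightarrow> B \<in> sets M \<Longrightarrow> measure (\<Psi> g) (A \<times> B) = g (A, B)" if "g \<in> K" for g
  proof -
    have "bimeasure M (\<lambda>A B. g (A, B))"
      using that by unfold_locales (auto simp: K_def)
    then have "\<exists>\<rho>. \<rho> \<in> C2 M \<and> (\<forall>A\<in>sets M. \<forall>B\<in>sets M. measure \<rho> (A \<times> B) = g (A, B))"
      using bimeasure.extends_to_coupling by blast
    from someI_ex[OF this] show "\<Psi> g \<in> C2 M" "\<And>A B. A \<in> sets M \<Longrightarrow> B \<in> sets M \<Longrightarrow> measure (\<Psi> g) (A \<times> B) = g (A, B)"
      unfolding \<Psi>_def by auto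
  qed
  have cont: "continuous_map (top_of_set (K \<inter> Q)) (C2_topology M) \<Psi>"
    unfolding C2_topology_def
  proof (rule continuous_on_generated_topo)
    fix U assume "U \<in> {{\<rho>\<in>C2 M. measure \<rho> (A \<times> B) \<in> W} | A B W. A \<in> sets M \<and> B \<in> sets M \<and> open W}"
    then obtain A B W where U: "U = {\<rho>\<in>C2 M. measure \<rho> (A \<times> B) \<in> W}" and s: "A \<in> sets M" "B \<in> sets M" and W: "open W"
      by blast
    have "open ((\<lambda>g::'a set \<times> 'a set \<Rightarrow> real. g (A, B)) -` W)"
      using W by (intro open_vimage continuous_on_product_coordinates)
    moreover have "\<Psi> -` U \<inter> topspace (top_of_set (K \<inter> Q)) = (K \<inter> Q) \<inter> (\<lambda>g. g (A, B)) -` W"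
      using \<Psi> s unfolding U by auto
    ultimately show "openin (top_of_set (K \<inter> Q)) (\<Psi> -` U \<inter> topspace (top_of_set (K \<inter> Q)))"
      by (simp add: openin_open_Int)
  next
    show "\<Psi> ` topspace (top_of_set (K \<inter> Q)) \<subseteq> \<Union>{{\<rho>\<in>C2 M. measure \<rho> (A \<times> B) \<in> W} | A B W. A \<in> sets M \<and> B \<in> sets M \<and> open W}"
      using \<Psi>(1) topspace_C2_topology unfolding C2_topology_def topology_generated_by_topspace by auto
  qed
  have "C2 M \<subseteq> \<Psi> ` (K \<inter> Q)"
  proof
    fix \<rho> assume \<rho>: "\<rho> \<in> C2 M"
    interpret r: prob_space \<rho> by (rule C2D(2)[OF \<rho>])
    interpret b: bimeasure M "\<lambda>A B. measure \<rho> (A \<times> B)" by (rule bimeasure_C2[OF \<rho>])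
    define g where "g = (\<lambda>(A, B). measure \<rho> (A \<times> B))"
    have g: "g \<in> K \<inter> Q" unfolding K_def Q_def g_def
      using b.add_left b.add_right b.marginal_left b.marginal_right by auto
    have "\<Psi> g = \<rho>" using \<Psi> g \<rho> by (intro C2_eqI) (auto simp: g_def)
    then show "\<rho> \<in> \<Psi> ` (K \<inter> Q)" using g by blast
  qed
  then have "\<Psi> ` (K \<inter> Q) = topspace (C2_topology M)"
    using \<Psi>(1) by (auto simp: topspace_C2_topology)
  moreover have "compactin (top_of_set (K \<inter> Q)) (K \<inter> Q)"
    using comp by (simp add: compactin_subtopology)
  ultimately show ?thesis
    using image_compactin[OF _ cont] by (metis compact_space_def)
qed

lemma C2_neighbourhood_base:
  assumes "openin (C2_topology M) V" "\<rho> \<in> V"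
  shows "\<exists>F e. finite F \<and> F \<subseteq> sets M \<times> sets M \<and> 0 < e \<and>
    {\<rho>'\<in>C2 M. \<forall>(A, B)\<in>F. \<bar>measure \<rho>' (A \<times> B) - measure \<rho> (A \<times> B)\<bar> < e} \<subseteq> V"
  using openin_topology_generated_by[OF assms(1)[unfolded C2_topology_def]] assms(2)
proof (induction rule: generate_topology_on.induct)
  case (Int a b)
  then obtain F e F' e' where
    *: "finite F" "F \<subseteq> sets M \<times> sets M" "0 < e"
      "{\<rho>'\<in>C2 M. \<forall>(A, B)\<in>F. \<bar>measure \<rho>' (A \<times> B) - measure \<rho> (A \<times> B)\<bar> < e} \<subseteq> a"
      "finite F'" "F' \<subseteq> sets M \<times> sets M" "0 < e'"
      "{\<rho>'\<in>C2 M. \<forall>(A, B)\<in>F'. \<bar>measure \<rho>' (A \<times> B) - measure \<rho> (A \<times> B)\<bar> < e'} \<subseteq> b"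
    by auto
  have "{\<rho>'\<in>C2 M. \<forall>(A, B)\<in>F \<union> F'. \<bar>measure \<rho>' (A \<times> B) - measure \<rho> (A \<times> B)\<bar> < min e e'} \<subseteq>
      {\<rho>'\<in>C2 M. \<forall>(A, B)\<in>F. \<bar>measure \<rho>' (A \<times> B) - measure \<rho> (A \<times> B)\<bar> < e} \<inter>
      {\<rho>'\<in>C2 M. \<forall>(A, B)\<in>F'. \<bar>measure \<rho>' (A \<times> B) - measure \<rho> (A \<times> B)\<bar> < e'}"
    by fastforce
  also have "\<dots> \<subseteq> a \<inter> b" using *(4,8) by (rule Int_mono)
  finally show ?case
    using *(1-3,5-7) by (intro exI[of _ "F \<union> F'"] exI[of _ "min e e'"]) simp
next
  case (UN K)
  then obtain k where "k \<in> K" "\<rho> \<in> k" by blast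
  then show ?case using UN.IH[of k] by (meson Union_upper subset_trans)
next
  case (Basis s)
  then obtain A B W where s: "s = {\<rho>\<in>C2 M. measure \<rho> (A \<times> B) \<in> W}" "A \<in> sets M" "B \<in> sets M" "open W" by blast
  obtain e where e: "0 < e" "\<And>y. dist y (measure \<rho> (A \<times> B)) < e \<Longrightarrow> y \<in> W"
    using s Basis(2) open_dist[of W] by auto
  then show ?case using s
    by (intro exI[of _ "{(A, B)}"] exI[of _ e]) (auto simp: dist_real_def)
qed simp

text \<open>The Lebesgue number argument without a metric: finitely many neighbourhoods of half the
  radius cover the compact space, \<open>F\<close> collects their rectangles, and the other half of
  the radius absorbs the passage from \<rho> to \<rho>'.\<close>

lemma C2_Lebesgue_number:
  assumes U: "U \<in> open_covers (C2_topology M)"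
  shows "\<exists>F e. finite F \<and> F \<subseteq> sets M \<times> sets M \<and> 0 < e \<and>
    (\<forall>\<rho>\<in>C2 M. \<exists>V\<in>U. \<forall>\<rho>'\<in>C2 M.
      (\<forall>(A, B)\<in>F. \<bar>measure \<rho>' (A \<times> B) - measure \<rho> (A \<times> B)\<bar> < e) \<longrightarrow> \<rho>' \<in> V)"
proof -
  let ?N = "\<lambda>F e \<rho>. {\<rho>'\<in>C2 M. \<forall>(A, B)\<in>F. \<bar>measure \<rho>' (A \<times> B) - measure \<rho> (A \<times> B)\<bar> < (e::real)}"
  define good where "good \<rho> V F e \<longleftrightarrow> V \<in> U \<and> finite F \<and> F \<subseteq> sets M \<times> sets M \<and> 0 < e \<and> ?N F e \<rho> \<subseteq> V"
    for \<rho> V F e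
  have "\<exists>V F e. good \<rho> V F e" if "\<rho> \<in> C2 M" for \<rho>
  proof -
    obtain V where "V \<in> U" "\<rho> \<in> V" "openin (C2_topology M) V"
      using U \<open>\<rho> \<in> C2 M\<close> unfolding open_covers_def topspace_C2_topology by blast
    then show ?thesis using C2_neighbourhood_base[of V \<rho>] unfolding good_def by blast
  qed
  then obtain V F e where "\<And>\<rho>. \<rho> \<in> C2 M \<Longrightarrow> good \<rho> (V \<rho>) (F \<rho>) (e \<rho>)" by metis
  then have *: "\<And>\<rho>. \<rho> \<in> C2 M \<Longrightarrow> V \<rho> \<in> U" "\<And>\<rho>. \<rho> \<in> C2 M \<Longrightarrow> finite (F \<rho>)"
    "\<And>\<rho>. \<rho> \<in> C2 M \<Longrightarrow> F \<rho> \<subseteq> sets M \<times> sets M" "\<And>\<rho>. \<rho> \<in> C2 M \<Longrightarrow> 0 < e \<rho>"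
    "\<And>\<rho>. \<rho> \<in> C2 M \<Longrightarrow> ?N (F \<rho>) (e \<rho>) \<rho> \<subseteq> V \<rho>"
    unfolding good_def by blast+
  define B where "B \<rho> = ?N (F \<rho>) (e \<rho> / 2) \<rho>" for \<rho>
  have opn: "openin (C2_topology M) (B \<rho>)" if \<rho>: "\<rho> \<in> C2 M" for \<rho>
  proof -
    let ?S = "\<lambda>(A, B). {\<rho>'\<in>C2 M. measure \<rho>' (A \<times> B) \<in> ball (measure \<rho> (A \<times> B)) (e \<rho> / 2)}"
    have "B \<rho> = topspace (C2_topology M) \<inter> \<Inter> (?S ` F \<rho>)"
      by (auto simp: B_def topspace_C2_topology dist_real_def abs_minus_commute)
    moreover have "openin (C2_topology M) (?S p)" if "p \<in> F \<rho>" for p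
    proof -
      obtain A C where "p = (A, C)" "A \<in> sets M" "C \<in> sets M"
        using \<open>p \<in> F \<rho>\<close> *(3)[OF \<rho>] by blast
      then show ?thesis using openin_C2_topology_rectangle[of A C "ball (measure \<rho> (A \<times> C)) (e \<rho> / 2)"]
        by simp
    qed
    ultimately show ?thesis using *(2)[OF \<rho>] by (auto intro!: openin_Int_Inter)
  qed
  have "topspace (C2_topology M) \<subseteq> \<Union> (B ` C2 M)"
    using *(4) by (auto simp: B_def topspace_C2_topology)
  moreover have "\<forall>W\<in>B ` C2 M. openin (C2_topology M) W"
    using opn by blast
  ultimately obtain \<F> where \<F>: "finite \<F>" "\<F> \<subseteq> B ` C2 M" "topspace (C2_topology M) \<subseteq> \<Union>\<F>"
    using compact_space_C2[unfolded compact_space_alt, THEN spec, of "B ` C2 M"] by (elim impE exE conjE) auto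
  obtain R where R: "R \<subseteq> C2 M" "finite R" "\<F> = B ` R"
    using finite_subset_image[OF \<F>(1,2)] by blast
  \<comment> \<open>The entry 1 keeps the minimum meaningful if \<open>R\<close> is empty.\<close>
  define d where "d = Min (insert 1 ((\<lambda>\<rho>. e \<rho> / 2) ` R))"
  have d: "0 < d" using R *(4) by (auto simp: d_def)
  have dle: "d \<le> e \<rho> / 2" if "\<rho> \<in> R" for \<rho>
    unfolding d_def using R(2) that by (intro Min_le) auto
  show ?thesis
  proof (intro exI[of _ "\<Union> (F ` R)"] exI[of _ d] conjI ballI)
    show "finite (\<Union> (F ` R))" "\<Union> (F ` R) \<subseteq> sets M \<times> sets M"
      using R *(2,3) by (auto simp: subset_iff)
    fix \<rho> assume \<rho>: "\<rho> \<in> C2 M"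
    then obtain \<sigma> where \<sigma>: "\<sigma> \<in> R" "\<rho> \<in> B \<sigma>" using \<F>(3) R by (auto simp: topspace_C2_topology)
    show "\<exists>V\<in>U. \<forall>\<rho>'\<in>C2 M. (\<forall>(A, B)\<in>\<Union> (F ` R). \<bar>measure \<rho>' (A \<times> B) - measure \<rho> (A \<times> B)\<bar> < d) \<longrightarrow> \<rho>' \<in> V"
    proof (intro bexI[of _ "V \<sigma>"] ballI impI)
      fix \<rho>' assume \<rho>': "\<rho>' \<in> C2 M"
        "\<forall>(A, B)\<in>\<Union> (F ` R). \<bar>measure \<rho>' (A \<times> B) - measure \<rho> (A \<times> B)\<bar> < d"
      have "\<bar>measure \<rho>' (A \<times> B) - measure \<sigma> (A \<times> B)\<bar> < e \<sigma>" if "(A, B) \<in> F \<sigma>" for A B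
      proof -
        have "\<bar>measure \<rho>' (A \<times> B) - measure \<rho> (A \<times> B)\<bar> < d" using \<rho>'(2) that \<sigma>(1) by blast
        moreover have "\<bar>measure \<rho> (A \<times> B) - measure \<sigma> (A \<times> B)\<bar> < e \<sigma> / 2" using \<sigma>(2) that unfolding B_def by blast
        ultimately show ?thesis using dle[OF \<sigma>(1)] by linarith
      qed
      then show "\<rho>' \<in> V \<sigma>" using *(5)[of \<sigma>] \<sigma>(1) R(1) \<rho>'(1) by blast
    qed (use *(1) \<sigma> R in auto)
  qed (rule d)
qed

end

section \<open>The lens of a zero entropy automorphism\<close>

lemma (in borel_prob_space) refining_partition:
  assumes F: "finite F" "F \<subseteq> sets M"
  shows "\<exists>P. finite_meas_partition M P \<and> (\<forall>p\<in>P. \<forall>A\<in>F. p \<subseteq> A \<or> p \<inter> A = {})"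
proof (intro exI conjI)
  let ?P = "cell F (\<lambda>A. A) ` Pow F"
  show "finite_meas_partition M ?P"
    unfolding finite_meas_partition_def
  proof (intro conjI)
    show "?P \<subseteq> sets M" using F full by (auto intro: sets_cell)
    show "disjoint ?P" using disjoint_family_cell by (rule disjoint_family_on_disjoint_image)
    have "x \<in> \<Union>?P" for x
      by (rule UN_I[of "{A \<in> F. x \<in> A}"]) (auto simp: cell_def)
    then show "\<Union>?P = space M" by (auto simp: full)
  qed (use F in simp)
  show "\<forall>p\<in>?P. \<forall>A\<in>F. p \<subseteq> A \<or> p \<inter> A = {}" by (auto simp: cell_def)
qed

text \<open>The weights \<open>measure \<rho> (a \<times> b)\<close> do not depend on the rectangle.
  One convex combination of 0-1 vectors therefore describes all times and all rectangles
  simultaneously.\<close>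

lemma (in borel_prob_space) C2_rectangle_eq_sum:
  assumes \<rho>: "\<rho> \<in> C2 M" and Q: "finite_meas_partition M Q"
    and C: "\<And>a. a \<in> Q \<Longrightarrow> a \<subseteq> C \<or> a \<inter> C = {}" and D: "\<And>a. a \<in> Q \<Longrightarrow> a \<subseteq> D \<or> a \<inter> D = {}"
  shows "measure \<rho> (C \<times> D) = (\<Sum>(a, b)\<in>Q \<times> Q. measure \<rho> (a \<times> b) * of_bool (a \<subseteq> C \<and> b \<subseteq> D))"
proof -
  interpret r: prob_space \<rho> by (rule C2D(2)[OF \<rho>])
  have fin: "finite Q" and meas: "\<And>a. a \<in> Q \<Longrightarrow> a \<in> sets M" and dis: "disjoint Q" and un: "\<Union>Q = UNIV"
    using Q by (auto simp: finite_meas_partition_def full)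
  define S where "S = {(a, b)\<in>Q \<times> Q. a \<subseteq> C \<and> b \<subseteq> D}"
  have in_atom: "\<exists>a\<in>Q. a \<subseteq> E \<and> x \<in> a" if "x \<in> E" "\<And>a. a \<in> Q \<Longrightarrow> a \<subseteq> E \<or> a \<inter> E = {}" for x E
    using un that by (metis IntI UNIV_I UnionE empty_iff)
  have "C \<times> D = (\<Union>(a, b)\<in>S. a \<times> b)"
    using in_atom[OF _ C] in_atom[OF _ D] by (auto simp: S_def) blast
  moreover have "disjoint_family_on (\<lambda>(a, b). a \<times> b) S"
  proof -
    have "a = a'" if "a \<in> Q" "a' \<in> Q" "x \<in> a" "x \<in> a'" for a a' x
      using dis that by (auto dest: disjointD)
    then show ?thesis unfolding disjoint_family_on_def S_def by auto
  qed
  moreover have "finite S" using fin unfolding S_def by (intro finite_subset[OF _ finite_cartesian_product[of Q Q]]) auto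
  moreover have "(\<lambda>(a, b). a \<times> b) ` S \<subseteq> sets \<rho>"
    using meas C2D(4)[OF \<rho>] by (auto simp: S_def)
  ultimately have "measure \<rho> (C \<times> D) = (\<Sum>p\<in>S. measure \<rho> (case p of (a, b) \<Rightarrow> a \<times> b))"
    using r.finite_measure_finite_Union[of S "\<lambda>(a, b). a \<times> b"] by simp
  also have "\<dots> = (\<Sum>p\<in>Q \<times> Q. measure \<rho> (case p of (a, b) \<Rightarrow> a \<times> b) * of_bool (case p of (a, b) \<Rightarrow> a \<subseteq> C \<and> b \<subseteq> D))"
    using fin by (intro sum.mono_neutral_cong_left) (auto simp: S_def)
  finally show ?thesis by (simp add: case_prod_beta)
qed

section \<open>Iterates of the lens and covering numbers\<close>

locale polish_automorphism = borel_prob_space M + full_automorphism M T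
  for M :: "'a::polish_space measure" and T
begin

lemma lens_C2:
  assumes \<rho>: "\<rho> \<in> C2 M"
  shows "lens M T \<rho> \<in> C2 M"
    and "A \<in> sets M \<Longrightarrow> B \<in> sets M \<Longrightarrow> measure (lens M T \<rho>) (A \<times> B) = measure \<rho> (T -` A \<times> T -` B)"
proof -
  interpret r: prob_space \<rho> by (rule C2D(2)[OF \<rho>])
  have T: "T \<in> measurable M M" "distr M M T = M" using aut by (auto simp: is_aut_def)
  note cong = measurable_cong_sets[OF C2D(1)[OF \<rho>] refl]
  let ?T = "\<lambda>(x, y). (T x, T y)"
  have TT: "?T \<in> measurable \<rho> (M \<Otimes>\<^sub>M M)"
    unfolding cong using T(1) by measurable
  have fs: "fst \<in> measurable \<rho> M" "snd \<in> measurable \<rho> M" unfolding cong by simp_all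
  have "distr (lens M T \<rho>) M fst = distr \<rho> M (fst \<circ> ?T)"
    unfolding lens_def using TT by (intro distr_distr) auto
  also have "fst \<circ> ?T = T \<circ> fst" by auto
  also have "distr \<rho> M (T \<circ> fst) = distr (distr \<rho> M fst) M T"
    using T fs by (intro distr_distr[symmetric]) auto
  finally have "distr (lens M T \<rho>) M fst = distr (distr \<rho> M fst) M T" .
  moreover have "distr (lens M T \<rho>) M snd = distr (distr \<rho> M snd) M T"
  proof -
    have "distr (lens M T \<rho>) M snd = distr \<rho> M (snd \<circ> ?T)"
      unfolding lens_def using TT by (intro distr_distr) auto
    also have "snd \<circ> ?T = T \<circ> snd" by auto
    also have "distr \<rho> M (T \<circ> snd) = distr (distr \<rho> M snd) M T"
      using T fs by (intro distr_distr[symmetric]) auto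
    finally show ?thesis .
  qed
  moreover have "prob_space (lens M T \<rho>)" unfolding lens_def by (rule r.prob_space_distr[OF TT])
  ultimately show "lens M T \<rho> \<in> C2 M" using \<rho> T by (simp add: C2_def) (simp add: lens_def)
  assume AB: "A \<in> sets M" "B \<in> sets M"
  have "?T -` (A \<times> B) = T -` A \<times> T -` B" by auto
  then show "measure (lens M T \<rho>) (A \<times> B) = measure \<rho> (T -` A \<times> T -` B)"
    unfolding lens_def using TT AB by (subst measure_distr) (auto simp: C2D(3)[OF \<rho>])
qed

lemma lens_iterate:
  assumes \<rho>: "\<rho> \<in> C2 M"
  shows "(lens M T ^^ i) \<rho> \<in> C2 M"
    and "A \<in> sets M \<Longrightarrow> B \<in> sets M \<Longrightarrow>
      measure ((lens M T ^^ i) \<rho>) (A \<times> B) = measure \<rho> ((T ^^ i) -` A \<times> (T ^^ i) -` B)"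
proof -
  show C2: "(lens M T ^^ i) \<rho> \<in> C2 M" for i by (induction i) (auto simp: \<rho> lens_C2)
  show "measure ((lens M T ^^ i) \<rho>) (A \<times> B) = measure \<rho> ((T ^^ i) -` A \<times> (T ^^ i) -` B)"
    if "A \<in> sets M" "B \<in> sets M" for A B
    using that
  \<comment> \<open>The outermost lens replaces \<open>A\<close> and \<open>B\<close> by their
    preimages under \<open>T\<close>, so the hypothesis is needed for other sets.\<close>
  proof (induction i arbitrary: A B)
    case (Suc i)
    have "T -` A \<in> sets M" "T -` B \<in> sets M" using Suc.prems sets_vimage_iterate[of _ 1] by auto
    then have "measure ((lens M T ^^ Suc i) \<rho>) (A \<times> B) = measure \<rho> ((T ^^ i) -` (T -` A) \<times> (T ^^ i) -` (T -` B))"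
      using Suc lens_C2(2)[OF C2[of i]] by simp
    then show ?case by (simp only: vimage_comp funpow.simps)
  qed simp
qed

lemma part_join_atom_cases:
  assumes a: "a \<in> part_join M T P n" and i: "i < n"
    and A: "\<And>p. p \<in> P \<Longrightarrow> p \<subseteq> A \<or> p \<inter> A = {}"
  shows "a \<subseteq> (T ^^ i) -` A \<or> a \<inter> (T ^^ i) -` A = {}"
proof -
  obtain f where f: "f \<in> {..<n} \<rightarrow>\<^sub>E P" "a = (\<Inter>i<n. (T ^^ i) -` f i)" using a by (auto simp: part_join_eq)
  then have "a \<subseteq> (T ^^ i) -` f i" "f i \<in> P" using i by auto
  then show ?thesis using A[of "f i"] by blast
qed

text \<open>One element of the join suffices per code word. Equal codes allow a difference of
  \<open>2 * d\<close>, and discarding small atoms costs \<open>2 * s\<close> for each of the two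
  couplings, whence \<open>2 * d + 4 * s < e\<close>. The entropy bound is the input of
  \<open>partition_large_atoms\<close> with \<open>c = s * n\<close>.\<close>

lemma cover_num_lens_le:
  fixes e d s z :: real
  assumes F: "finite F" "F \<subseteq> sets M \<times> sets M"
    and leb: "\<And>\<rho>. \<rho> \<in> C2 M \<Longrightarrow> \<exists>V\<in>U. \<forall>\<rho>'\<in>C2 M.
      (\<forall>(A, B)\<in>F. \<bar>measure \<rho>' (A \<times> B) - measure \<rho> (A \<times> B)\<bar> < e) \<longrightarrow> \<rho>' \<in> V"
    and P: "finite_meas_partition M P" "\<And>p A B. p \<in> P \<Longrightarrow> (A, B) \<in> F \<Longrightarrow> (p \<subseteq> A \<or> p \<inter> A = {}) \<and> (p \<subseteq> B \<or> p \<inter> B = {})"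
    and n: "0 < n" and m: "0 < m" and z: "0 < z" "z \<le> 1" and s: "0 < s"
    and d: "0 < d" "2 * d + 4 * s < e"
    and ent: "part_entropy M (part_join M T P n) \<le> s * (s * real n)"
  shows "real (cover_num (C2_topology M) (cover_join (C2_topology M) (lens M T) U n)) \<le>
    (2 * exp (2 * (s * real n))) ^ m *
      (z powr (- (real (n * card F) / (real m * d\<^sup>2))) * (1 + (1 / d + 1) * z) ^ (n * card F))"
proof -
  define Q where "Q = part_join M T P n"
  have Q: "finite_meas_partition M Q" unfolding Q_def by (rule finite_meas_partition_part_join[OF P(1)])
  have finQ: "finite Q" and measQ: "\<And>a. a \<in> Q \<Longrightarrow> a \<in> sets M" and disQ: "disjoint Q" and unQ: "\<Union>Q = UNIV"
    using Q by (auto simp: finite_meas_partition_def full)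
  define G where "G = {a \<in> Q. exp (- (s * real n)) \<le> prob a}"
  have G: "real (card G) \<le> exp (s * real n)" "(\<Sum>a\<in>Q - G. prob a) \<le> s"
    unfolding G_def using partition_large_atoms[OF Q, of s "s * real n"] ent n s by (auto simp: Q_def)
  define I where "I = {..<n} \<times> F"
  have finI: "finite I" and cardI: "card I = n * card F" using F by (auto simp: I_def card_cartesian_product)
  define y :: "'a set \<times> 'a set \<Rightarrow> nat \<times> 'a set \<times> 'a set \<Rightarrow> real" where
    "y = (\<lambda>(a, b) (i, A, B). of_bool (a \<subseteq> (T ^^ i) -` A \<and> b \<subseteq> (T ^^ i) -` B))"
  \<comment> \<open>Pairs with a small atom are not removed but receive the zero vector: the weights
    still sum to 1, and the set of vectors grows by at most one.\<close>
  define x where "x = (\<lambda>(a, b) j. if a \<in> G \<and> b \<in> G then y (a, b) j else 0)"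
  define w where "w \<rho> = (\<lambda>(a, b). measure \<rho> (a \<times> b))" for \<rho> :: "('a \<times> 'a) measure"
  define app where "app \<rho> j = (\<Sum>p\<in>Q \<times> Q. w \<rho> p * x p j)" for \<rho> j
  have w0: "0 \<le> w \<rho> p" for \<rho> p by (simp add: w_def case_prod_beta)
  have y01: "y p j \<in> {0..1}" for p j by (auto simp: y_def split: prod.splits)
  have x01: "x p j \<in> {0..1}" for p j using y01 by (auto simp: x_def split: prod.splits)

  have wsum_left: "(\<Sum>b\<in>Q. w \<rho> (a, b)) = prob a" if "\<rho> \<in> C2 M" "a \<in> Q" for \<rho> a
  proof -
    interpret b: bimeasure M "\<lambda>A B. measure \<rho> (A \<times> B)" by (rule bimeasure_C2[OF that(1)])
    show ?thesis
      using b.UN_right[of Q "\<lambda>b. b" a] finQ measQ that(2) disQ unQ b.marginal_left[of a]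
      by (simp add: w_def disjoint_family_on_def disjoint_def)
  qed
  have wsum_right: "(\<Sum>a\<in>Q. w \<rho> (a, b)) = prob b" if "\<rho> \<in> C2 M" "b \<in> Q" for \<rho> b
  proof -
    interpret b: bimeasure M "\<lambda>A B. measure \<rho> (A \<times> B)" by (rule bimeasure_C2[OF that(1)])
    show ?thesis
      using b.UN_left[of Q "\<lambda>b. b" b] finQ measQ that(2) disQ unQ b.marginal_right[of b]
      by (simp add: w_def disjoint_family_on_def disjoint_def)
  qed
  \<comment> \<open>Passing from \<open>y\<close> to \<open>x\<close> loses at most the mass of
    pairs with a small atom. By the marginals, each factor accounts for at most \<open>s\<close>,
    whatever the coupling.\<close>
  have approx: "\<bar>measure ((lens M T ^^ i) \<rho>) (A \<times> B) - app \<rho> (i, A, B)\<bar> \<le> 2 * s"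
    if \<rho>: "\<rho> \<in> C2 M" and i: "i < n" and AB: "(A, B) \<in> F" for \<rho> i A B
  proof -
    let ?j = "(i, A, B)"
    have "A \<in> sets M" "B \<in> sets M" using AB F by auto
    then have "measure ((lens M T ^^ i) \<rho>) (A \<times> B) = measure \<rho> ((T ^^ i) -` A \<times> (T ^^ i) -` B)"
      by (rule lens_iterate(2)[OF \<rho>])
    also have "\<dots> = (\<Sum>(a, b)\<in>Q \<times> Q. measure \<rho> (a \<times> b) * of_bool (a \<subseteq> (T ^^ i) -` A \<and> b \<subseteq> (T ^^ i) -` B))"
      using P(2) AB i by (intro C2_rectangle_eq_sum[OF \<rho> Q] part_join_atom_cases[where P=P]) (auto simp: Q_def)
    also have "\<dots> = (\<Sum>p\<in>Q \<times> Q. w \<rho> p * y p ?j)"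
      by (simp add: w_def y_def case_prod_beta)
    finally have eq: "measure ((lens M T ^^ i) \<rho>) (A \<times> B) - app \<rho> ?j = (\<Sum>p\<in>Q \<times> Q. w \<rho> p * (y p ?j - x p ?j))"
      by (simp add: app_def right_diff_distrib sum_subtractf)
    have ge: "0 \<le> (\<Sum>p\<in>Q \<times> Q. w \<rho> p * (y p ?j - x p ?j))"
      using w0 y01 by (intro sum_nonneg mult_nonneg_nonneg) (auto simp: x_def)
    have "(\<Sum>p\<in>Q \<times> Q. w \<rho> p * (y p ?j - x p ?j)) \<le>
        (\<Sum>(a, b)\<in>Q \<times> Q. w \<rho> (a, b) * of_bool (a \<notin> G) + w \<rho> (a, b) * of_bool (b \<notin> G))"
    proof (rule sum_mono, clarify)
      fix a b
      have "y (a, b) ?j - x (a, b) ?j \<le> of_bool (a \<notin> G) + of_bool (b \<notin> G)"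
        using y01[of "(a, b)" ?j] by (auto simp: x_def)
      then have "w \<rho> (a, b) * (y (a, b) ?j - x (a, b) ?j) \<le> w \<rho> (a, b) * (of_bool (a \<notin> G) + of_bool (b \<notin> G))"
        using w0 by (rule mult_left_mono)
      then show "w \<rho> (a, b) * (y (a, b) ?j - x (a, b) ?j) \<le> w \<rho> (a, b) * of_bool (a \<notin> G) + w \<rho> (a, b) * of_bool (b \<notin> G)"
        by (simp add: distrib_left)
    qed
    also have "\<dots> = (\<Sum>a\<in>Q. \<Sum>b\<in>Q. w \<rho> (a, b) * of_bool (a \<notin> G)) + (\<Sum>b\<in>Q. \<Sum>a\<in>Q. w \<rho> (a, b) * of_bool (b \<notin> G))"
      by (subst sum.swap[of _ Q Q]) (simp only: sum.cartesian_product[symmetric] sum.distrib)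
    also have "\<dots> = (\<Sum>a\<in>Q. prob a * of_bool (a \<notin> G)) + (\<Sum>b\<in>Q. prob b * of_bool (b \<notin> G))"
      using wsum_left[OF \<rho>] wsum_right[OF \<rho>] by (simp only: sum_distrib_right[symmetric] cong: sum.cong)
    also have "(\<Sum>a\<in>Q. prob a * of_bool (a \<notin> G)) = (\<Sum>a\<in>Q - G. prob a)"
      using finQ by (intro sum.mono_neutral_cong_right) auto
    finally show ?thesis using G(2) eq ge by simp
  qed

  have hull: "\<forall>u\<in>app ` C2 M. \<exists>v. (\<forall>p\<in>Q \<times> Q. 0 \<le> v p) \<and> sum v (Q \<times> Q) = 1 \<and> (\<forall>j\<in>I. u j = (\<Sum>p\<in>Q \<times> Q. v p * x p j))"
  proof
    fix u assume "u \<in> app ` C2 M"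
    then obtain \<rho> where \<rho>: "\<rho> \<in> C2 M" "u = app \<rho>" by blast
    have "sum (w \<rho>) (Q \<times> Q) = (\<Sum>a\<in>Q. \<Sum>b\<in>Q. w \<rho> (a, b))" by (simp add: sum.cartesian_product)
    also have "\<dots> = 1" using wsum_left[OF \<rho>(1)] partition_sum_measure_space[OF Q] by simp
    finally show "\<exists>v. (\<forall>p\<in>Q \<times> Q. 0 \<le> v p) \<and> sum v (Q \<times> Q) = 1 \<and> (\<forall>j\<in>I. u j = (\<Sum>p\<in>Q \<times> Q. v p * x p j))"
      using w0 \<rho>(2) by (intro exI[of _ "w \<rho>"]) (auto simp: app_def)
  qed
  obtain code :: "(nat \<times> 'a set \<times> 'a set \<Rightarrow> real) \<Rightarrow> (nat \<times> 'a set \<times> 'a set \<Rightarrow> real) list \<times> (nat \<times> 'a set \<times> 'a set \<Rightarrow> nat)"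
    where code: "finite (code ` app ` C2 M)"
      "real (card (code ` app ` C2 M)) \<le> real (card (x ` (Q \<times> Q))) ^ m *
      (z powr (- (real (card I) / (real m * d\<^sup>2))) * (1 + (1 / d + 1) * z) ^ card I)"
      "\<And>u v j. u \<in> app ` C2 M \<Longrightarrow> v \<in> app ` C2 M \<Longrightarrow> code u = code v \<Longrightarrow> j \<in> I \<Longrightarrow> \<bar>u j - v j\<bar> \<le> 2 * d"
  proof -
    show thesis
      using convex_hull_sup_coding[OF finite_cartesian_product[OF finQ finQ] finI x01 d(1) m z hull]
      by (elim exE conjE) (rule that, assumption+, blast)
  qed

  have cardx: "real (card (x ` (Q \<times> Q))) \<le> 2 * exp (2 * (s * real n))"
  proof -
    have "x p \<in> insert (\<lambda>_. 0) (x ` (G \<times> G))" for p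
    proof (cases p)
      case (Pair a b)
      show ?thesis
      proof (cases "a \<in> G \<and> b \<in> G")
        case True
        then show ?thesis unfolding Pair by blast
      next
        case False
        then have "x p = (\<lambda>_. 0)" by (auto simp: x_def Pair)
        then show ?thesis by simp
      qed
    qed
    then have sub: "x ` (Q \<times> Q) \<subseteq> insert (\<lambda>_. 0) (x ` (G \<times> G))" by blast
    have finG: "finite G" using finQ by (simp add: G_def)
    have "card (x ` (Q \<times> Q)) \<le> card (insert (\<lambda>_. 0) (x ` (G \<times> G)))"
      using finG by (intro card_mono sub) auto
    also have "\<dots> \<le> Suc (card (x ` (G \<times> G)))" by (rule card_insert_le_m1) auto
    also have "\<dots> \<le> Suc (card G * card G)"
      using card_image_le[of "G \<times> G" x] finG by (simp add: card_cartesian_product)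
    finally have "real (card (x ` (Q \<times> Q))) \<le> 1 + real (card G) * real (card G)"
      by (metis of_nat_Suc of_nat_le_iff of_nat_mult add.commute)
    also have "\<dots> \<le> 1 + exp (s * real n) * exp (s * real n)"
      using G(1) by (intro add_left_mono mult_mono) auto
    also have "\<dots> = 1 + exp (2 * (s * real n))" by (simp flip: exp_add)
    also have "\<dots> \<le> 2 * exp (2 * (s * real n))" using s by simp
    finally show ?thesis .
  qed

  define c where "c \<rho> = code (app \<rho>)" for \<rho>
  have "\<exists>V. \<forall>\<rho>\<in>C2 M. V \<rho> \<in> U \<and> (\<forall>\<rho>'\<in>C2 M.
      (\<forall>(A, B)\<in>F. \<bar>measure \<rho>' (A \<times> B) - measure \<rho> (A \<times> B)\<bar> < e) \<longrightarrow> \<rho>' \<in> V \<rho>)"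
    using leb by (intro bchoice) blast
  then obtain V where V: "\<And>\<rho>. \<rho> \<in> C2 M \<Longrightarrow> V \<rho> \<in> U"
    "\<And>\<rho> \<rho>'. \<rho> \<in> C2 M \<Longrightarrow> \<rho>' \<in> C2 M \<Longrightarrow> (\<And>A B. (A, B) \<in> F \<Longrightarrow> \<bar>measure \<rho>' (A \<times> B) - measure \<rho> (A \<times> B)\<bar> < e) \<Longrightarrow> \<rho>' \<in> V \<rho>"
    by blast
  define r where "r k = inv_into (C2 M) c k" for k
  have r: "r k \<in> C2 M" "c (r k) = k" if "k \<in> c ` C2 M" for k
    using that by (auto simp: r_def inv_into_into f_inv_into_f)
  \<comment> \<open>The element for a code word is built along the orbit of one representative.
    Every coupling with the same code follows this orbit up to \<open>e\<close> on the rectangles of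
    \<open>F\<close>.\<close>
  define W where "W k = (\<Inter>i<n. (lens M T ^^ i) -` V ((lens M T ^^ i) (r k))) \<inter> topspace (C2_topology M)" for k
  let ?\<W> = "W ` c ` C2 M"
  have ceq: "c ` C2 M = code ` app ` C2 M" by (auto simp: c_def)
  have "?\<W> \<subseteq> cover_join (C2_topology M) (lens M T) U n"
  proof (rule image_subsetI)
    fix k assume "k \<in> c ` C2 M"
    then have "V ((lens M T ^^ i) (r k)) \<in> U" for i
      by (intro V(1) lens_iterate(1) r(1))
    then show "W k \<in> cover_join (C2_topology M) (lens M T) U n"
      unfolding cover_join_def W_def
      by (intro CollectI exI[of _ "\<lambda>i. V ((lens M T ^^ i) (r k))"]) auto
  qed
  moreover have "finite ?\<W>" using code(1) by (simp add: ceq)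
  moreover have "\<Union>?\<W> = topspace (C2_topology M)"
  proof
    show "\<Union>?\<W> \<subseteq> topspace (C2_topology M)" by (auto simp: W_def)
    show "topspace (C2_topology M) \<subseteq> \<Union>?\<W>"
    proof
      fix \<rho> assume "\<rho> \<in> topspace (C2_topology M)"
      then have \<rho>: "\<rho> \<in> C2 M" by (simp add: topspace_C2_topology)
      define \<sigma> where "\<sigma> = r (c \<rho>)"
      have \<sigma>: "\<sigma> \<in> C2 M" "c \<sigma> = c \<rho>" using r \<rho> by (auto simp: \<sigma>_def)
      have "(lens M T ^^ i) \<rho> \<in> V ((lens M T ^^ i) \<sigma>)" if i: "i < n" for i
      proof (rule V(2)[OF lens_iterate(1)[OF \<sigma>(1)] lens_iterate(1)[OF \<rho>]])
        fix A B assume AB: "(A, B) \<in> F"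
        have "\<bar>app \<rho> (i, A, B) - app \<sigma> (i, A, B)\<bar> \<le> 2 * d"
          using \<rho> \<sigma> i AB by (intro code(3)) (auto simp: c_def I_def)
        then show "\<bar>measure ((lens M T ^^ i) \<rho>) (A \<times> B) - measure ((lens M T ^^ i) \<sigma>) (A \<times> B)\<bar> < e"
          using approx[OF \<rho> i AB] approx[OF \<sigma>(1) i AB] d(2) by linarith
      qed
      then have "\<rho> \<in> W (c \<rho>)" using \<rho> by (auto simp: W_def topspace_C2_topology \<sigma>_def)
      then show "\<rho> \<in> \<Union>?\<W>" using \<rho> by blast
    qed
  qed
  ultimately have "cover_num (C2_topology M) (cover_join (C2_topology M) (lens M T) U n) \<le> card ?\<W>"
    unfolding cover_num_def by (intro cInf_lower CollectI exI[of _ ?\<W>] conjI refl bdd_below_bot)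
  also have "\<dots> \<le> card (code ` app ` C2 M)"
    unfolding ceq[symmetric] using code(1) by (intro card_image_le) (simp add: ceq)
  finally have "real (cover_num (C2_topology M) (cover_join (C2_topology M) (lens M T) U n)) \<le> real (card (code ` app ` C2 M))"
    by (rule of_nat_mono)
  also note code(2)
  also have "real (card (x ` (Q \<times> Q))) ^ m * (z powr (- (real (card I) / (real m * d\<^sup>2))) * (1 + (1 / d + 1) * z) ^ card I)
    \<le> (2 * exp (2 * (s * real n))) ^ m * (z powr (- (real (card I) / (real m * d\<^sup>2))) * (1 + (1 / d + 1) * z) ^ card I)"
    using cardx d(1) z by (intro mult_right_mono power_mono mult_nonneg_nonneg) auto
  finally show ?thesis by (simp add: cardI)
qed

text \<open>After taking logarithms and dividing by \<open>n\<close>, the bound of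
  \<open>cover_num_lens_le\<close> has four terms: \<open>m * ln 2 / n\<close>,
  \<open>2 * s * m\<close>, \<open>f * (- ln z) / (m * d\<^sup>2)\<close> and at most
  \<open>f * (1 / d + 1) * z\<close>. Each is made at most \<open>t\<close>.\<close>

lemma cover_entropy_lens_eq_0:
  assumes ks: "ks_entropy M T = 0" and U: "U \<in> open_covers (C2_topology M)"
  shows "cover_entropy (C2_topology M) (lens M T) U = 0"
proof -
  let ?N = "\<lambda>n. cover_num (C2_topology M) (cover_join (C2_topology M) (lens M T) U n)"
  obtain F e where F: "finite F" "F \<subseteq> sets M \<times> sets M" and e: "0 < e"
    and leb: "\<And>\<rho>. \<rho> \<in> C2 M \<Longrightarrow> \<exists>V\<in>U. \<forall>\<rho>'\<in>C2 M.
      (\<forall>(A, B)\<in>F. \<bar>measure \<rho>' (A \<times> B) - measure \<rho> (A \<times> B)\<bar> < e) \<longrightarrow> \<rho>' \<in> V"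
    using C2_Lebesgue_number[OF U] by blast
  have "finite (fst ` F \<union> snd ` F)" "fst ` F \<union> snd ` F \<subseteq> sets M" using F by auto
  from refining_partition[OF this] obtain P where P: "finite_meas_partition M P"
    "\<forall>p\<in>P. \<forall>A\<in>fst ` F \<union> snd ` F. p \<subseteq> A \<or> p \<inter> A = {}"
    by (elim exE conjE)
  have Pref: "(p \<subseteq> A \<or> p \<inter> A = {}) \<and> (p \<subseteq> B \<or> p \<inter> B = {})" if "p \<in> P" "(A, B) \<in> F" for p A B
  proof -
    have "A \<in> fst ` F \<union> snd ` F" "B \<in> fst ` F \<union> snd ` F"
      using imageI[OF that(2), of fst] imageI[OF that(2), of snd] by auto
    then show ?thesis using P(2) that(1) by (intro conjI) (drule bspec, assumption, drule bspec, assumption+)+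
  qed
  define f where "f = real (card F)"
  define d where "d = e / 4"
  have d: "0 < d" using e by (simp add: d_def)
  have f0: "0 \<le> f" by (simp add: f_def)
  have lim: "(\<lambda>n. ln (real (?N n)) / real n) \<longlonglongrightarrow> 0"
  proof (rule LIMSEQ_I)
    fix \<epsilon> :: real assume \<epsilon>: "0 < \<epsilon>"
    \<comment> \<open>Four terms use \<open>t\<close> each; the fifth share makes the final
      inequality strict.\<close>
    define t where "t = \<epsilon> / 5"
    have t: "0 < t" using \<epsilon> by (simp add: t_def)
    have fd: "0 < (f + 1) * (1 / d + 1)" using d f0 by (intro mult_pos_pos add_nonneg_pos) auto
    \<comment> \<open>The summand in \<open>f + 1\<close> keeps the divisor positive when
      \<open>F\<close> is empty, and the cap at 1 is required by the Chernoff count.\<close>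
    define z where "z = min 1 (t / ((f + 1) * (1 / d + 1)))"
    have z: "0 < z" "z \<le> 1" using divide_pos_pos[OF t fd] by (auto simp: z_def)
    have zt: "f * ((1 / d + 1) * z) \<le> t"
    proof -
      have "f * ((1 / d + 1) * z) \<le> (f + 1) * (1 / d + 1) * z"
        using d z unfolding mult.assoc by (intro mult_right_mono mult_nonneg_nonneg) auto
      also have "\<dots> \<le> (f + 1) * (1 / d + 1) * (t / ((f + 1) * (1 / d + 1)))"
        using less_imp_le[OF fd] by (intro mult_left_mono) (auto simp: z_def)
      also have "\<dots> = t" using less_imp_neq[OF fd] by (metis nonzero_mult_div_cancel_left times_divide_eq_right)
      finally show ?thesis .
    qed
    obtain m' :: nat where m': "f * (- ln z) / d\<^sup>2 / t < real m'" using reals_Archimedean2 by blast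
    define m where "m = Suc m'"
    have m: "0 < m" by (simp add: m_def)
    have mt: "f * (- ln z) / (real m * d\<^sup>2) \<le> t"
    proof -
      have "f * (- ln z) / d\<^sup>2 < real m' * t" using m' by (simp only: pos_divide_less_eq[OF t])
      also have "\<dots> \<le> t * real m" using t by (simp add: m_def)
      finally have "f * (- ln z) / d\<^sup>2 / real m \<le> t"
        using m by (simp only: pos_divide_le_eq of_nat_0_less_iff less_imp_le)
      then show ?thesis by (simp add: mult.commute)
    qed
    \<comment> \<open>The first bound gives \<open>4 * s \<le> e / 4\<close>, which together with
      \<open>2 * d = e / 2\<close> stays below \<open>e\<close>; the second gives
      \<open>2 * s * m \<le> t\<close>.\<close>
    define s where "s = min (e / 16) (t / (2 * real m))"
    have s: "0 < s" using e t m by (simp add: s_def)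
    have ds: "2 * d + 4 * s < e" using e by (simp add: d_def s_def)
    have st: "2 * s * real m \<le> t"
    proof -
      have "2 * s * real m \<le> 2 * (t / (2 * real m)) * real m"
        by (intro mult_right_mono mult_left_mono) (auto simp: s_def)
      then show ?thesis using m by simp
    qed
    have "\<forall>\<^sub>F n in sequentially. part_entropy M (part_join M T P n) / real n < s * s"
      using part_entropy_part_join_tendsto_0[OF ks P(1)] s by (intro order_tendstoD) auto
    moreover have "\<forall>\<^sub>F n in sequentially. real m * ln 2 / real n < t"
      using lim_const_over_n[of "real m * ln 2"] t by (intro order_tendstoD) auto
    ultimately have "\<forall>\<^sub>F n in sequentially. norm (ln (real (?N n)) / real n - 0) < \<epsilon>"
      using eventually_gt_at_top[of 0]
    proof eventually_elim
      fix n :: nat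
      assume ent: "part_entropy M (part_join M T P n) / real n < s * s"
        and small: "real m * ln 2 / real n < t" and n: "0 < n"
      have n0: "0 < real n" using n by simp
      let ?R1 = "(2 * exp (2 * (s * real n))) ^ m"
      let ?R2 = "z powr (- (real (n * card F) / (real m * d\<^sup>2)))"
      let ?R3 = "(1 + (1 / d + 1) * z) ^ (n * card F)"
      have q: "0 < (1 / d + 1) * z" using d z by (intro mult_pos_pos) (auto intro: add_pos_pos)
      have pos: "0 < ?R1" "0 < ?R2" "0 < ?R3" using z q by (auto intro!: zero_less_power)
      have "part_entropy M (part_join M T P n) \<le> s * (s * real n)"
        using ent n0 by (simp add: pos_divide_less_eq mult.assoc)
      then have N: "real (?N n) \<le> ?R1 * (?R2 * ?R3)"
        by (intro cover_num_lens_le[OF F leb P(1) Pref n m z s d ds]) auto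
      have "ln (real (?N n)) \<le> 5 * t * real n - t * real n"
      \<comment> \<open>A zero covering number is covered by the convention
        \<open>ln 0 = 0\<close>.\<close>
      proof (cases "?N n = 0")
        case True
        then show ?thesis using t n0 by simp
      next
        case False
        then have "ln (real (?N n)) \<le> ln (?R1 * (?R2 * ?R3))" using N by (subst ln_le_cancel_iff) (use pos in auto)
        also have "\<dots> = ln ?R1 + (ln ?R2 + ln ?R3)" using pos by (simp add: ln_mult_pos)
        also have "ln ?R1 = real m * ln 2 + 2 * s * real m * real n"
          by (simp add: ln_realpow ln_mult_pos algebra_simps)
        also have "ln ?R2 = f * (- ln z) / (real m * d\<^sup>2) * real n"
          using z by (simp add: ln_powr f_def)
        also have "ln ?R3 \<le> f * ((1 / d + 1) * z) * real n"
        proof -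
          have "ln ?R3 = real n * f * ln (1 + (1 / d + 1) * z)" using q by (subst ln_realpow) (auto simp: f_def)
          also have "\<dots> \<le> real n * f * ((1 / d + 1) * z)"
            using q f0 by (intro mult_left_mono ln_add_one_self_le_self) auto
          finally show ?thesis by (simp add: mult_ac)
        qed
        also have "real m * ln 2 \<le> t * real n" using small n0 by (simp add: pos_divide_less_eq)
        also have "2 * s * real m * real n \<le> t * real n" using st n0 by (intro mult_right_mono) auto
        also have "f * (- ln z) / (real m * d\<^sup>2) * real n \<le> t * real n" using mt n0 by (intro mult_right_mono) auto
        also have "f * ((1 / d + 1) * z) * real n \<le> t * real n" using zt n0 by (intro mult_right_mono) auto
        finally show ?thesis by (simp add: algebra_simps)
      qed
      moreover have "0 < t * real n" using t n0 by simp
      ultimately have "ln (real (?N n)) < \<epsilon> * real n" by (simp add: t_def)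
      then have "ln (real (?N n)) / real n < \<epsilon>" using n0 by (simp add: pos_divide_less_eq)
      moreover have "0 \<le> ln (real (?N n)) / real n"
        by (cases "?N n = 0") (auto intro!: divide_nonneg_nonneg ln_ge_zero)
      ultimately show "norm (ln (real (?N n)) / real n - 0) < \<epsilon>" by simp
    qed
    then show "\<exists>no. \<forall>n\<ge>no. norm (ln (real (?N n)) / real n - 0) < \<epsilon>"
      by (simp add: eventually_sequentially)
  qed
  then show ?thesis unfolding cover_entropy_def by (rule limI)
qed

end

theorem mainTheorem14:
  fixes \<mu> :: "'a::polish_space measure" and T :: "'a \<Rightarrow> 'a"
  assumes "prob_space \<mu>"
    and "space \<mu> = UNIV" and "sets \<mu> = sets borel"
    and "is_aut \<mu> T"
    and "ergodic \<mu> T"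
    and "ks_entropy \<mu> T = 0"
  shows "top_entropy (C2_topology \<mu>) (lens \<mu> T) = 0"
proof -
  interpret prob_space \<mu> by fact
  interpret polish_automorphism \<mu> T
    by unfold_locales (use assms in auto)
  \<comment> \<open>Some open cover must exist: over the empty set the supremum in
    \<open>ereal\<close> would be minus infinity instead of 0.\<close>
  have "{topspace (C2_topology \<mu>)} \<in> open_covers (C2_topology \<mu>)"
    by (simp add: open_covers_def)
  then have "open_covers (C2_topology \<mu>) \<noteq> {}" by blast
  then have "(SUP U\<in>open_covers (C2_topology \<mu>). 0 :: ereal) = 0" by (rule SUP_const)
  moreover have "top_entropy (C2_topology \<mu>) (lens \<mu> T) = (SUP U\<in>open_covers (C2_topology \<mu>). 0)"
    unfolding top_entropy_def
    by (intro SUP_cong refl) (simp add: cover_entropy_lens_eq_0[OF assms(6)])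
  ultimately show ?thesis by simp
qed

end
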